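(* Let $K_1,K_2$ be compact Hausdorff spaces with finite, strictly positive, Borel measures $\mu_1$ and $\mu_2$, respectively. Then $(\Delta(K_1,\mu_1)^\circ,d_H)$ and $(\Delta(K_2,\mu_2)^\circ,d_H)$ are isometric if and only if $K_1$ and $K_2$ are homeomorphic.
   Context: For a compact Hausdorff space $K$, $C(K)$ is the space of real-valued continuous functions on $K$. A finite Borel measure $\mu$ on $K$ is strictly positive if $\int f\,\mathrm{d}\mu>0$ for all $f\in C(K)$ with $f\ne 0$ and $f(x)\ge 0$ for all $x\in K$. For such $\mu$, $$\Delta(K,\mu)^\circ:=\{f\in C(K): f(x)>0\text{ for all }x\in K\text{ and }\textstyle\int f\,\mathrm{d}\mu=1\}.$$ Hilbert's metric on $\Delta(K,\mu)^\circ$ is $d_H(f,g)=\log\big(M(f/g)M(g/f)\big)$, where $M(f/g)=\inf\{\beta>0: f(x)\le\beta g(x)\text{ for all }x\in K\}$. Two metric spaces are isometric if there is a surjective isometry from one onto the other. *)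

theory Defs
  imports "HOL-Analysis.Analysis"
begin

text \<open>
  A function on a space \<open>K\<close> is represented by its extensional representative, which is
  \<open>undefined\<close> outside \<open>topspace K\<close>, so that equality of representatives is equality of functions
  on \<open>K\<close>. No topology or metric on \<open>C(K)\<close> is used.
\<close>

definition cont_funs :: "'a topology \<Rightarrow> ('a \<Rightarrow> real) set" where
  "cont_funs K = {f \<in> extensional (topspace K). continuous_map K euclideanreal f}"

text \<open>The library's \<open>borel\<close> is tied to a type class; this is the version for an explicit topology.\<close>

definition borel_measure_on :: "'a topology \<Rightarrow> 'a measure \<Rightarrow> bool" where
  "borel_measure_on K \<mu> \<longleftrightarrow> sets \<mu> = sets (sigma (topspace K) {U. openin K U})"

lemma borel_measure_on_space: "space \<mu> = topspace K" if "borel_measure_on K \<mu>"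
proof -
  have "{U. openin K U} \<subseteq> Pow (topspace K)"
    by (auto dest: openin_subset)
  then show ?thesis
    using that sets_eq_imp_space_eq[of \<mu> "sigma (topspace K) {U. openin K U}"]
    by (simp add: borel_measure_on_def space_measure_of)
qed

text \<open>
  The Bochner integral is \<open>0\<close> for non-integrable functions. This never matters here: for a finite
  Borel measure on a compact space every function in \<open>C(K)\<close> is integrable, as shown next.
\<close>

lemma integrable_cont_funs:
  assumes "compact_space K" "borel_measure_on K \<mu>" "finite_measure \<mu>" "f \<in> cont_funs K"
  shows "integrable \<mu> f"
proof -
  interpret finite_measure \<mu> by fact
  have sp: "space \<mu> = topspace K"
    using assms(2) by (rule borel_measure_on_space)
  have cont: "continuous_map K euclideanreal f"
    using assms(4) by (simp add: cont_funs_def)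
  have sub: "{U. openin K U} \<subseteq> Pow (topspace K)"
    by (auto dest: openin_subset)
  have meas: "f \<in> borel_measurable \<mu>"
  proof (rule borel_measurableI)
    fix S :: "real set" assume "open S"
    then have "openin K {x \<in> topspace K. f x \<in> S}"
      using cont by (simp add: continuous_map_def)
    moreover have "f -` S \<inter> space \<mu> = {x \<in> topspace K. f x \<in> S}"
      using sp by auto
    ultimately show "f -` S \<inter> space \<mu> \<in> sets \<mu>"
      using assms(2) sub by (auto simp: borel_measure_on_def sets_measure_of)
  qed
  have "compactin euclideanreal (f ` topspace K)"
    using assms(1) cont image_compactin compact_space_def by blast
  then have "bounded (f ` topspace K)"
    by (simp add: compact_imp_bounded)
  then obtain B where "\<And>x. x \<in> topspace K \<Longrightarrow> norm (f x) \<le> B"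
    by (auto simp: bounded_iff)
  then show ?thesis
    using sp meas by (intro integrable_const_bound[where B = B]) auto
qed

definition strictly_positive_on :: "'a topology \<Rightarrow> 'a measure \<Rightarrow> bool" where
  "strictly_positive_on K \<mu> \<longleftrightarrow>
     (\<forall>f \<in> cont_funs K.
        (\<exists>x \<in> topspace K. f x \<noteq> 0) \<and> (\<forall>x \<in> topspace K. f x \<ge> 0) \<longrightarrow> (\<integral>x. f x \<partial>\<mu>) > 0)"

definition simplex_interior :: "'a topology \<Rightarrow> 'a measure \<Rightarrow> ('a \<Rightarrow> real) set" where
  "simplex_interior K \<mu> =
     {f \<in> cont_funs K. (\<forall>x \<in> topspace K. f x > 0) \<and> (\<integral>x. f x \<partial>\<mu>) = 1}"

definition hilbert_M :: "'a topology \<Rightarrow> ('a \<Rightarrow> real) \<Rightarrow> ('a \<Rightarrow> real) \<Rightarrow> real" where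
  "hilbert_M K f g = Inf {\<beta>. \<beta> > 0 \<and> (\<forall>x \<in> topspace K. f x \<le> \<beta> * g x)}"

definition hilbert_dist :: "'a topology \<Rightarrow> ('a \<Rightarrow> real) \<Rightarrow> ('a \<Rightarrow> real) \<Rightarrow> real" where
  "hilbert_dist K f g = ln (hilbert_M K f g * hilbert_M K g f)"

text \<open>
  Metric spaces are given by a carrier and a distance that is only relevant on the carrier.
  (The locale \<open>Metric_space\<close> also asks for nonnegativity and symmetry off the carrier, which is
  of no concern here.)
\<close>

definition isometric ::
  "'a set \<Rightarrow> ('a \<Rightarrow> 'a \<Rightarrow> real) \<Rightarrow> 'b set \<Rightarrow> ('b \<Rightarrow> 'b \<Rightarrow> real) \<Rightarrow> bool" where
  "isometric X dX Y dY \<longleftrightarrow>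
     (\<exists>\<phi>. \<phi> ` X = Y \<and> (\<forall>x \<in> X. \<forall>y \<in> X. dY (\<phi> x) (\<phi> y) = dX x y))"

end

theory Submission
  imports Defs
begin

text \<open>
  Since \<open>M(f/g) = max f/g\<close>, logarithms turn Hilbert's metric into the oscillation seminorm
  \<open>max u - min u\<close> on continuous functions modulo constants. An isometry preserves midpoints
  (Mazur--Ulam), so after a translation it is additive. For \<open>x \<noteq> y\<close> let \<open>S(x, y)\<close> be the set of \<open>u\<close>
  whose oscillation equals \<open>u x - u y\<close>. These sets are exactly the maximal ones on which the
  oscillation is additive, so the isometry induces a bijection between the pairs of distinct points
  of the two spaces. It preserves and reflects the property that the sets of two pairs meet in a
  nonconstant function, which means that neither pair begins where the other ends. Hence, up to
  replacing the isometry by its negative (which reverses every pair), it comes from a bijection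
  \<open>\<sigma>\<close> of points. As \<open>\<sigma>\<close> respects maximum and minimum sets of corresponding functions, Urysohn's
  lemma makes it continuous.
\<close>

section \<open>The oscillation seminorm\<close>

text \<open>For continuous \<open>u\<close> on a nonempty compact space this is maximum minus
  minimum. Taking the supremum over ordered pairs keeps maximum and minimum points together, as
  \<open>peak\<close> requires.\<close>

definition osc :: "'a topology \<Rightarrow> ('a \<Rightarrow> real) \<Rightarrow> real" where
  "osc K u = (SUP (x, y) \<in> topspace K \<times> topspace K. u x - u y)"

lemma continuous_map_attains_bounds:
  fixes u :: "'a \<Rightarrow> real"
  assumes "compact_space K" "topspace K \<noteq> {}" "continuous_map K euclideanreal u"
  obtains x y where "x \<in> topspace K" "y \<in> topspace K"
    "\<And>z. z \<in> topspace K \<Longrightarrow> u z \<le> u x" "\<And>z. z \<in> topspace K \<Longrightarrow> u y \<le> u z"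
proof -
  have "compactin euclideanreal (u ` topspace K)"
    using assms image_compactin compact_space_def by blast
  then have c: "compact (u ` topspace K)" "u ` topspace K \<noteq> {}"
    using assms(2) by auto
  obtain s where s: "s \<in> u ` topspace K" "\<And>t. t \<in> u ` topspace K \<Longrightarrow> t \<le> s"
    using compact_attains_sup[OF c] by blast
  obtain r where r: "r \<in> u ` topspace K" "\<And>t. t \<in> u ` topspace K \<Longrightarrow> r \<le> t"
    using compact_attains_inf[OF c] by blast
  from r(1) s(1) obtain x y where "x \<in> topspace K" "y \<in> topspace K" "s = u x" "r = u y"
    by auto
  then show ?thesis
    using r(2) s(2) by (intro that[of x y]) auto
qed

lemma osc_eqI:
  assumes "x \<in> topspace K" "y \<in> topspace K"
    and "\<And>z. z \<in> topspace K \<Longrightarrow> u z \<le> u x" "\<And>z. z \<in> topspace K \<Longrightarrow> u y \<le> u z"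
  shows "osc K u = u x - u y"
  unfolding osc_def
proof (rule cSup_eq_maximum)
  show "u x - u y \<in> (\<lambda>(x, y). u x - u y) ` (topspace K \<times> topspace K)"
    using assms(1,2) by force
  fix t assume "t \<in> (\<lambda>(x, y). u x - u y) ` (topspace K \<times> topspace K)"
  then show "t \<le> u x - u y"
    using assms(3,4) by (auto intro: diff_mono)
qed

lemma osc_attained:
  assumes "compact_space K" "topspace K \<noteq> {}" "continuous_map K euclideanreal u"
  obtains x y where "x \<in> topspace K" "y \<in> topspace K" "u x - u y = osc K u"
  by (metis continuous_map_attains_bounds[OF assms] osc_eqI)

lemma diff_le_osc:
  assumes "compact_space K" "continuous_map K euclideanreal u" "x \<in> topspace K" "y \<in> topspace K"
  shows "u x - u y \<le> osc K u"
proof -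
  obtain a b where "a \<in> topspace K" "b \<in> topspace K"
    "\<And>z. z \<in> topspace K \<Longrightarrow> u z \<le> u a" "\<And>z. z \<in> topspace K \<Longrightarrow> u b \<le> u z"
    using continuous_map_attains_bounds[OF assms(1) _ assms(2)] assms(3) by blast
  then show ?thesis
    using osc_eqI[of a K b u] assms(3,4) by (metis diff_mono)
qed

text \<open>Constants cancel in differences, so \<open>osc\<close> makes sense on functions modulo
  constants.\<close>

lemma osc_cong: "(\<And>x. x \<in> topspace K \<Longrightarrow> u x = v x + c) \<Longrightarrow> osc K u = osc K v"
  unfolding osc_def by (intro SUP_cong) auto

lemma osc_minus:
  assumes "compact_space K" "topspace K \<noteq> {}" "continuous_map K euclideanreal u"
  shows "osc K (\<lambda>x. - u x) = osc K u"
proof -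
  obtain x y where "x \<in> topspace K" "y \<in> topspace K"
    "\<And>z. z \<in> topspace K \<Longrightarrow> u z \<le> u x" "\<And>z. z \<in> topspace K \<Longrightarrow> u y \<le> u z"
    using continuous_map_attains_bounds[OF assms] by blast
  then show ?thesis
    using osc_eqI[of x K y u] osc_eqI[of y K x "\<lambda>x. - u x"] by simp
qed

lemma osc_eq_0:
  assumes "compact_space K" "topspace K \<noteq> {}" "continuous_map K euclideanreal u" "osc K u = 0"
  obtains c where "\<And>x. x \<in> topspace K \<Longrightarrow> u x = c"
proof -
  obtain z where z: "z \<in> topspace K"
    using assms(2) by blast
  have "u x = u z" if "x \<in> topspace K" for x
    using diff_le_osc[OF assms(1,3) that z] diff_le_osc[OF assms(1,3) z that] assms(4) by simp
  then show ?thesis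
    using that by blast
qed

lemma osc_triangle:
  assumes "compact_space K" "topspace K \<noteq> {}"
    and "continuous_map K euclideanreal u" "continuous_map K euclideanreal v"
  shows "osc K (\<lambda>x. u x + v x) \<le> osc K u + osc K v"
proof -
  have "continuous_map K euclideanreal (\<lambda>x. u x + v x)"
    using assms(3,4) by (rule continuous_map_add)
  from osc_attained[OF assms(1,2) this]
  obtain x y where xy: "x \<in> topspace K" "y \<in> topspace K"
    and eq: "(u x + v x) - (u y + v y) = osc K (\<lambda>x. u x + v x)" .
  have "u x - u y \<le> osc K u" "v x - v y \<le> osc K v"
    using diff_le_osc[OF assms(1) _ xy] assms(3,4) by blast+
  with eq show ?thesis by linarith
qed

lemma osc_mult_left:
  assumes "compact_space K" "topspace K \<noteq> {}" "continuous_map K euclideanreal u" "0 \<le> c"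
  shows "osc K (\<lambda>x. c * u x) = c * osc K u"
proof -
  obtain x y where xy: "x \<in> topspace K" "y \<in> topspace K"
    "\<And>z. z \<in> topspace K \<Longrightarrow> u z \<le> u x" "\<And>z. z \<in> topspace K \<Longrightarrow> u y \<le> u z"
    using continuous_map_attains_bounds[OF assms(1-3)] by blast
  have "osc K (\<lambda>x. c * u x) = c * u x - c * u y"
    using xy assms(4) by (intro osc_eqI) (auto intro: mult_left_mono)
  then show ?thesis
    using osc_eqI[of x K y u, OF xy] by (simp add: right_diff_distrib)
qed

section \<open>Peak pairs\<close>

text \<open>For continuous \<open>u\<close> on compact \<open>K\<close> and points of
  \<open>K\<close>, this says that \<open>u\<close> is maximal at \<open>x\<close> and minimal at
  \<open>y\<close>; for \<open>x \<noteq> y\<close> it is membership of \<open>u\<close> in S(x,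
  y).\<close>

definition peak :: "'a topology \<Rightarrow> ('a \<Rightarrow> real) \<Rightarrow> 'a \<Rightarrow> 'a \<Rightarrow> bool" where
  "peak K u x y \<longleftrightarrow> u x - u y = osc K u"

text \<open>Urysohn's lemma gives a function into \<open>{0..1}\<close>. As both sets are nonempty
  it attains 0 and 1, so its oscillation is exactly 1 and every pair from
  \<open>S \<times> T\<close> is a peak pair.\<close>

lemma separating_function:
  assumes "compact_space K" "Hausdorff_space K" "closedin K S" "closedin K T" "S \<inter> T = {}"
    and "S \<noteq> {}" "T \<noteq> {}"
  obtains u where "continuous_map K euclideanreal u" "osc K u = 1"
    "\<And>x. x \<in> S \<Longrightarrow> u x = 1" "\<And>x. x \<in> T \<Longrightarrow> u x = 0"
    "\<And>x y. x \<in> S \<Longrightarrow> y \<in> T \<Longrightarrow> peak K u x y"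
proof -
  have "normal_space K"
    using assms(1,2) compact_Hausdorff_or_regular_imp_normal_space by blast
  then obtain u where u: "continuous_map K (top_of_set {0..1::real}) u" "u ` T \<subseteq> {0}" "u ` S \<subseteq> {1}"
    using Urysohn_lemma[of K T S 0 1] assms by (auto simp: disjnt_def)
  have cont: "continuous_map K euclideanreal u" and rng: "\<And>x. x \<in> topspace K \<Longrightarrow> 0 \<le> u x \<and> u x \<le> 1"
    using u(1) by (auto simp: continuous_map_in_subtopology image_subset_iff Pi_iff)
  obtain s t where st: "s \<in> S" "t \<in> T"
    using assms(6,7) by blast
  then have "s \<in> topspace K" "t \<in> topspace K"
    using assms(3,4) closedin_subset by blast+
  moreover have "u s = 1" "u t = 0"
    using u st by auto
  ultimately have o: "osc K u = 1"
    using osc_eqI[of s K t u] rng by simp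
  show ?thesis
    using u(2,3) by (intro that[of u] cont o) (auto simp: peak_def o image_subset_iff)
qed

text \<open>If \<open>p \<noteq> p'\<close>, take \<open>w\<close> of oscillation 1 that is 1 at
  \<open>p\<close> and 0 at \<open>q\<close> and \<open>p'\<close>. Peaking at
  \<open>(p', q')\<close> would force \<open>w q' = -1\<close>, and the difference 2 between
  \<open>p\<close> and \<open>q'\<close> exceeds the oscillation. The case
  \<open>q \<noteq> q'\<close> is dual.\<close>

lemma peak_unique:
  assumes "compact_space K" "Hausdorff_space K"
    and "p \<in> topspace K" "q \<in> topspace K" "p \<noteq> q" "p' \<in> topspace K" "q' \<in> topspace K"
    and imp: "\<And>w. continuous_map K euclideanreal w \<Longrightarrow> peak K w p q \<Longrightarrow> peak K w p' q'"
  shows "p = p' \<and> q = q'"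
proof -
  have cl: "closedin K S" if "finite S" "S \<subseteq> topspace K" for S
    using assms(1,2) that by (simp add: Hausdorff_imp_t1_space closedin_Hausdorff_finite)
  have "p = p'"
  proof (rule ccontr)
    assume "p \<noteq> p'"
    with assms(3-7) have "{p} \<inter> {q, p'} = {}" by auto
    then obtain w where w: "continuous_map K euclideanreal w" "osc K w = 1"
      "\<And>x. x \<in> {p} \<Longrightarrow> w x = 1" "\<And>x. x \<in> {q, p'} \<Longrightarrow> w x = 0"
      "\<And>x y. x \<in> {p} \<Longrightarrow> y \<in> {q, p'} \<Longrightarrow> peak K w x y"
      using separating_function[OF assms(1,2), of "{p}" "{q, p'}"] cl assms by auto
    have "peak K w p' q'"
      using w imp by simp
    then have "w p - w q' = 2"
      using w by (simp add: peak_def)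
    then show False
      using diff_le_osc[OF assms(1) w(1), of p q'] assms w(2) by simp
  qed
  moreover have "q = q'"
  proof (rule ccontr)
    assume "q \<noteq> q'"
    with assms(3-7) have "{p, q'} \<inter> {q} = {}" by auto
    then obtain w where w: "continuous_map K euclideanreal w" "osc K w = 1"
      "\<And>x. x \<in> {p, q'} \<Longrightarrow> w x = 1" "\<And>x. x \<in> {q} \<Longrightarrow> w x = 0"
      "\<And>x y. x \<in> {p, q'} \<Longrightarrow> y \<in> {q} \<Longrightarrow> peak K w x y"
      using separating_function[OF assms(1,2), of "{p, q'}" "{q}"] cl assms by auto
    have "peak K w p' q'"
      using w imp by simp
    then have "w p' - w q = 2"
      using w by (simp add: peak_def)
    then show False
      using diff_le_osc[OF assms(1) w(1), of p' q] assms w(2) by simp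
  qed
  ultimately show ?thesis by blast
qed

text \<open>When one pair begins where the other ends, adding the two peak identities gives a
  difference of \<open>2 * osc K u\<close>, so \<open>osc K u = 0\<close>. Otherwise the first
  points can be separated from the second points. Incidence of pairs is thus expressed in a form
  that an oscillation-preserving correspondence transports.\<close>

lemma common_peak_function_iff:
  assumes "compact_space K" "Hausdorff_space K"
    and "x \<in> topspace K" "y \<in> topspace K" "x \<noteq> y" "x' \<in> topspace K" "y' \<in> topspace K" "x' \<noteq> y'"
  shows "(\<exists>u. continuous_map K euclideanreal u \<and> osc K u \<noteq> 0 \<and> peak K u x y \<and> peak K u x' y')
         \<longleftrightarrow> x \<noteq> y' \<and> y \<noteq> x'"
proof
  assume "\<exists>u. continuous_map K euclideanreal u \<and> osc K u \<noteq> 0 \<and> peak K u x y \<and> peak K u x' y'"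
  then obtain u where u: "continuous_map K euclideanreal u" "osc K u \<noteq> 0" "peak K u x y" "peak K u x' y'"
    by blast
  have "u x - u x \<le> osc K u" "u x' - u y \<le> osc K u" "u x - u y' \<le> osc K u"
    using diff_le_osc[OF assms(1) u(1)] assms by blast+
  with u show "x \<noteq> y' \<and> y \<noteq> x'"
    by (auto simp: peak_def)
next
  assume "x \<noteq> y' \<and> y \<noteq> x'"
  then have "{x, x'} \<inter> {y, y'} = {}"
    using assms by auto
  moreover have "closedin K {x, x'}" "closedin K {y, y'}"
    using assms by (simp_all add: closedin_Hausdorff_finite)
  ultimately show "\<exists>u. continuous_map K euclideanreal u \<and> osc K u \<noteq> 0 \<and> peak K u x y \<and> peak K u x' y'"
    by (metis separating_function[OF assms(1,2)] insertCI insert_not_empty zero_neq_one)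
qed

section \<open>Additive correspondences preserving the oscillation\<close>

text \<open>A relation instead of a map, because an isometry determines images only up to constants.
  The conditions are symmetric in \<open>K\<close> and \<open>L\<close>, so a correspondence can be
  read backwards.\<close>

definition osc_corr :: "'a topology \<Rightarrow> 'b topology \<Rightarrow> (('a \<Rightarrow> real) \<Rightarrow> ('b \<Rightarrow> real) \<Rightarrow> bool) \<Rightarrow> bool" where
  "osc_corr K L R \<longleftrightarrow>
     (\<forall>u w. R u w \<longrightarrow> continuous_map K euclideanreal u \<and> continuous_map L euclideanreal w \<and> osc K u = osc L w) \<and>
     (\<forall>u. continuous_map K euclideanreal u \<longrightarrow> (\<exists>w. R u w)) \<and>
     (\<forall>w. continuous_map L euclideanreal w \<longrightarrow> (\<exists>u. R u w)) \<and>
     R (\<lambda>_. 0) (\<lambda>_. 0) \<and>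
     (\<forall>u w u' w'. R u w \<longrightarrow> R u' w' \<longrightarrow> R (\<lambda>x. u x + u' x) (\<lambda>x. w x + w' x)) \<and>
     (\<forall>u w. R u w \<longrightarrow> R (\<lambda>x. - u x) (\<lambda>x. - w x))"

lemma osc_corrD:
  assumes "osc_corr K L R"
  shows "R u w \<Longrightarrow> continuous_map K euclideanreal u" "R u w \<Longrightarrow> continuous_map L euclideanreal w"
    "R u w \<Longrightarrow> osc K u = osc L w"
    "continuous_map K euclideanreal u \<Longrightarrow> \<exists>w. R u w"
    "continuous_map L euclideanreal w \<Longrightarrow> \<exists>u. R u w"
    "R u w \<Longrightarrow> R u' w' \<Longrightarrow> R (\<lambda>x. u x + u' x) (\<lambda>x. w x + w' x)"
    "R u w \<Longrightarrow> R (\<lambda>x. - u x) (\<lambda>x. - w x)"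
  using assms unfolding osc_corr_def by blast+

lemma osc_corr_conversep: "osc_corr K L R \<Longrightarrow> osc_corr L K (\<lambda>w u. R u w)"
  unfolding osc_corr_def by simp

text \<open>Negating \<open>w\<close> exchanges its maximum and minimum points, so the pairs of
  \<open>L\<close> matched with those of \<open>K\<close> get reversed. This reduces the case where
  rows and columns are exchanged to the other case.\<close>

lemma osc_corr_minus:
  assumes "osc_corr K L R" "compact_space L" "topspace L \<noteq> {}"
  shows "osc_corr K L (\<lambda>u w. R u (\<lambda>x. - w x))"
  unfolding osc_corr_def
proof (intro conjI allI impI)
  show "\<exists>w. R u (\<lambda>x. - w x)" if u: "continuous_map K euclideanreal u" for u
  proof -
    obtain w where "R u w"
      using osc_corrD(4)[OF assms(1), OF u] by blast
    then show ?thesis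
      by (intro exI[of _ "\<lambda>x. - w x"]) simp
  qed
  show "R (\<lambda>_. 0) (\<lambda>_. - 0)"
    using assms(1) by (simp add: osc_corr_def)
  fix u w assume *: "R u (\<lambda>x. - w x)"
  then show "continuous_map K euclideanreal u" "continuous_map L euclideanreal w"
    using osc_corrD(1,2)[OF assms(1)] by fastforce+
  then show "osc K u = osc L w"
    using osc_corrD(3)[OF assms(1), OF *] osc_minus[OF assms(2,3)] by simp
  show "R (\<lambda>x. - u x) (\<lambda>x. - (- w x))"
    using osc_corrD(7)[OF assms(1), OF *] .
  fix u' w' assume "R u' (\<lambda>x. - w' x)"
  then show "R (\<lambda>x. u x + u' x) (\<lambda>x. - (w x + w' x))"
    using osc_corrD(6)[OF assms(1), OF *, of u' "\<lambda>x. - w' x"] by (simp add: algebra_simps)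
next
  show "\<exists>u. R u (\<lambda>x. - w x)" if "continuous_map L euclideanreal w" for w
    using osc_corrD(5)[OF assms(1)] that by simp
qed

lemma osc_corr_sum:
  assumes "osc_corr K L R" "finite F" "\<And>i. i \<in> F \<Longrightarrow> R (f i) (g i)"
  shows "R (\<lambda>x. \<Sum>i\<in>F. f i x) (\<lambda>x. \<Sum>i\<in>F. g i x)"
  using assms(2,3)
proof (induction F rule: finite_induct)
  case empty
  then show ?case using assms(1) by (simp add: osc_corr_def)
next
  case (insert a F)
  have "R (\<lambda>x. \<Sum>i\<in>F. f i x) (\<lambda>x. \<Sum>i\<in>F. g i x)"
    using insert.IH insert.prems by blast
  moreover have "R (f a) (g a)"
    using insert.prems by blast
  ultimately have "R (\<lambda>x. f a x + (\<Sum>i\<in>F. f i x)) (\<lambda>x. g a x + (\<Sum>i\<in>F. g i x))"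
    by (intro osc_corrD(6)[OF assms(1)])
  then show ?case
    using insert.hyps by simp
qed

text \<open>
  On functions with a common peak pair the oscillation is additive, and conversely a finite family
  on which it is additive has a common peak pair, namely that of the sum. Additivity transfers
  along \<open>R\<close>, and compactness passes from finite to arbitrary families.
\<close>

lemma osc_corr_peak_transfer:
  assumes "osc_corr K L R" "compact_space K" "topspace K \<noteq> {}"
    and "compact_space L" "Hausdorff_space L"
    and pq: "p \<in> topspace L" "q \<in> topspace L" "p \<noteq> q"
  obtains x y where "x \<in> topspace K" "y \<in> topspace K" "x \<noteq> y"
    "\<And>u w. R u w \<Longrightarrow> peak L w p q \<Longrightarrow> peak K u x y"
proof -
  define A where "A = {u. \<exists>w. R u w \<and> peak L w p q}"
  define Z where "Z u = {z \<in> topspace (prod_topology K K). u (fst z) - u (snd z) = osc K u}" for u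
  have "\<forall>u\<in>A. \<exists>w. R u w \<and> peak L w p q"
    by (simp add: A_def)
  then obtain g where g: "\<And>u. u \<in> A \<Longrightarrow> R u (g u) \<and> peak L (g u) p q"
    by metis
  note RD = osc_corrD[OF assms(1)]
  have cont: "continuous_map K euclideanreal u" if "u \<in> A" for u
    using g[OF that] RD(1) by blast
  have closed: "closedin (prod_topology K K) (Z u)" if "u \<in> A" for u
  proof -
    have "continuous_map (prod_topology K K) euclideanreal (\<lambda>z. u (fst z) - u (snd z))"
      by (intro continuous_map_diff continuous_map_compose[OF continuous_map_fst cont[OF that], unfolded o_def]
          continuous_map_compose[OF continuous_map_snd cont[OF that], unfolded o_def])
    from closedin_continuous_map_preimage[OF this, of "{osc K u}"] show ?thesis
      by (simp add: Z_def)
  qed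
  have fip: "\<Inter>\<F> \<noteq> {}" if "finite \<F>" "\<F> \<subseteq> Z ` A" for \<F>
  proof -
    obtain F where F: "F \<subseteq> A" "finite F" "\<F> = Z ` F"
      using finite_subset_image[OF \<open>finite \<F>\<close> \<open>\<F> \<subseteq> Z ` A\<close>] by blast
    define U where "U x = (\<Sum>u\<in>F. u x)" for x
    define W where "W x = (\<Sum>u\<in>F. g u x)" for x
    have R: "R U W"
      unfolding U_def W_def using F g by (intro osc_corr_sum[OF assms(1)]) auto
    obtain x y where xy: "x \<in> topspace K" "y \<in> topspace K" "U x - U y = osc K U"
      using osc_attained[OF assms(2,3) RD(1)[OF R]] by blast
    have "(\<Sum>u\<in>F. osc K u) = (\<Sum>u\<in>F. g u p - g u q)"
    proof (rule sum.cong)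
      fix u assume "u \<in> F"
      then have "R u (g u)" "peak L (g u) p q"
        using g F by auto
      then show "osc K u = g u p - g u q"
        using RD(3) by (simp add: peak_def)
    qed simp
    also have "\<dots> = W p - W q"
      by (simp add: W_def sum_subtractf)
    also have "\<dots> \<le> osc K U"
      using diff_le_osc[OF assms(4) RD(2)[OF R] pq(1,2)] RD(3)[OF R] by simp
    also have "\<dots> = (\<Sum>u\<in>F. u x - u y)"
      using xy(3) by (simp add: U_def sum_subtractf)
    finally have le: "(\<Sum>u\<in>F. osc K u) \<le> (\<Sum>u\<in>F. u x - u y)" .
    have each: "u x - u y \<le> osc K u" if "u \<in> F" for u
      using diff_le_osc[OF assms(2) cont xy(1,2)] F that by blast
    \<comment> \<open>Each summand is bounded by its oscillation and the sums agree, so no single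
      inequality is strict.\<close>
    have "u x - u y = osc K u" if "u \<in> F" for u
    proof (rule sum_mono_inv[of "\<lambda>u. u x - u y" F "osc K"])
      show "(\<Sum>u\<in>F. u x - u y) = (\<Sum>u\<in>F. osc K u)"
        using le sum_mono[of F "\<lambda>u. u x - u y" "osc K"] each by (intro antisym) blast+
    qed (use each that F(2) in auto)
    then have "(x, y) \<in> \<Inter>\<F>"
      using xy F by (auto simp: Z_def)
    then show ?thesis by blast
  qed
  have "compact_space (prod_topology K K)"
    using assms(2) by (simp add: compact_space_prod_topology)
  then have "\<Inter>(Z ` A) \<noteq> {}"
    unfolding compact_space_fip by (elim allE[of _ "Z ` A"]) (use closed fip in auto)
  then obtain z where z: "\<And>u. u \<in> A \<Longrightarrow> z \<in> Z u"
    by blast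
  \<comment> \<open>The common point \<open>z\<close> might still lie on the diagonal. A member of
    \<open>A\<close> with oscillation 1 forces its coordinates to differ.\<close>
  have "closedin L {p}" "closedin L {q}" "{p} \<inter> {q} = {}"
    using pq assms(5) by (auto simp: closedin_Hausdorff_sing_eq)
  from separating_function[OF assms(4,5) this]
  obtain w where w: "continuous_map L euclideanreal w" "osc L w = 1" "peak L w p q"
    by (metis insertI1 insert_not_empty)
  then obtain u where u: "R u w"
    using RD(5) by blast
  then have "u \<in> A" "osc K u = 1"
    using w RD(3) by (auto simp: A_def)
  then have "fst z \<in> topspace K" "snd z \<in> topspace K" "fst z \<noteq> snd z"
    using z[of u] by (auto simp: Z_def)
  moreover have "peak K u (fst z) (snd z)" if "R u w" "peak L w p q" for u w
    using z[of u] that by (auto simp: Z_def A_def peak_def)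
  ultimately show ?thesis
    using that by blast
qed

text \<open>Transferring \<open>(x, y)\<close> to \<open>(p, q)\<close> and back yields a pair at
  which every function peaking at \<open>(x, y)\<close> peaks. By \<open>peak_unique\<close> it is
  \<open>(x, y)\<close> itself, so the implications become equivalences.\<close>

lemma osc_corr_peak_iff:
  assumes "osc_corr K L R" "compact_space K" "Hausdorff_space K" "topspace K \<noteq> {}"
    and "compact_space L" "Hausdorff_space L" "topspace L \<noteq> {}"
    and xy: "x \<in> topspace K" "y \<in> topspace K" "x \<noteq> y"
  obtains p q where "p \<in> topspace L" "q \<in> topspace L" "p \<noteq> q"
    "\<And>u w. R u w \<Longrightarrow> peak K u x y \<longleftrightarrow> peak L w p q"
proof -
  obtain p q where pq: "p \<in> topspace L" "q \<in> topspace L" "p \<noteq> q"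
    "\<And>u w. R u w \<Longrightarrow> peak K u x y \<Longrightarrow> peak L w p q"
    using osc_corr_peak_transfer[OF osc_corr_conversep[OF assms(1)] assms(5,7,2,3) xy] by metis
  obtain x' y' where xy': "x' \<in> topspace K" "y' \<in> topspace K" "x' \<noteq> y'"
    "\<And>u w. R u w \<Longrightarrow> peak L w p q \<Longrightarrow> peak K u x' y'"
    using osc_corr_peak_transfer[OF assms(1,2,4,5,6) pq(1,2,3)] by metis
  have "x = x' \<and> y = y'"
    using peak_unique[OF assms(2,3) xy xy'(1,2)] osc_corrD(4)[OF assms(1)] pq(4) xy'(4) by metis
  then show ?thesis
    using that pq xy'(4) by metis
qed

section \<open>From pairs to points\<close>

text \<open>
  \<open>P\<close> encodes the map \<open>(x, y) \<mapsto> (P x y, P y x)\<close> on off-diagonal pairs, which must respect rows or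
  exchange rows with columns.
\<close>

lemma rows_or_columns:
  fixes P :: "'a \<Rightarrow> 'a \<Rightarrow> 'b"
  assumes ne: "\<And>x y. x \<in> X \<Longrightarrow> y \<in> X \<Longrightarrow> x \<noteq> y \<Longrightarrow> P x y \<noteq> P y x"
    and iff: "\<And>x y x' y'. x \<in> X \<Longrightarrow> y \<in> X \<Longrightarrow> x \<noteq> y \<Longrightarrow> x' \<in> X \<Longrightarrow> y' \<in> X \<Longrightarrow> x' \<noteq> y' \<Longrightarrow>
      (x = x' \<or> y = y') \<longleftrightarrow> (P x y = P x' y' \<or> P y x = P y' x')"
  shows "(\<forall>x\<in>X. \<forall>y\<in>X. \<forall>z\<in>X. x \<noteq> y \<longrightarrow> x \<noteq> z \<longrightarrow> P x y = P x z) \<or>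
         (\<forall>x\<in>X. \<forall>y\<in>X. \<forall>z\<in>X. x \<noteq> y \<longrightarrow> x \<noteq> z \<longrightarrow> P y x = P z x)"
proof (rule ccontr)
  assume "\<not> ?thesis"
  then obtain x y z x' y' z'
    where 1: "x \<in> X" "y \<in> X" "z \<in> X" "x \<noteq> y" "x \<noteq> z" "P x y \<noteq> P x z"
      and 2: "x' \<in> X" "y' \<in> X" "z' \<in> X" "x' \<noteq> y'" "x' \<noteq> z'" "P y' x' \<noteq> P z' x'"
    by blast
  \<comment> \<open>Any two pairs in row \<open>x\<close> have images agreeing in a coordinate.
    Since \<open>P x y \<noteq> P x z\<close>, the second coordinates at \<open>y\<close> and
    \<open>z\<close> agree; a different value \<open>P v x\<close> would force \<open>P x v\<close>
    to equal both \<open>P x y\<close> and \<open>P x z\<close>.\<close>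
  have col: "P v x = P y x" if "v \<in> X" "v \<noteq> x" for v
    using iff[of x y x v] iff[of x z x v] iff[of x y x z] 1 that by metis
  have row: "P x' v = P x' y'" if "v \<in> X" "v \<noteq> x'" for v
    using iff[of x' y' x' v] iff[of x' z' x' v] iff[of x' y' x' z'] 2 that by metis
  show False
  proof (cases "x = x'")
    case True
    then show ?thesis
      using row 1 by metis
  next
    case False
    obtain v where v: "v \<in> X" "v \<noteq> x" "v \<noteq> x'"
      using 1 2 by metis
    \<comment> \<open>A constant column at \<open>x\<close> meets a constant row at
      \<open>x'\<close>. The pairs \<open>(x, v)\<close> and \<open>(x', v)\<close> share their
      second entry, and agreement of their images in either coordinate would give
      \<open>P x v = P v x\<close> or \<open>P v x' = P x' v\<close>.\<close>
    have "P x' x = P v x" "P x' x = P x' v"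
      using col row v False 1 2 by metis+
    moreover have "P x v = P x' v \<or> P v x = P v x'"
      using iff[of x v x' v] v False 1 2 by blast
    ultimately show False
      using ne v 1 2 by metis
  qed
qed

text \<open>If \<open>\<sigma> a\<close> lies outside a closed set \<open>F\<close>, separate
  \<open>F\<close> from \<open>\<sigma> a\<close> by some \<open>w\<close>. A partner
  \<open>u\<close> of \<open>w\<close> exceeds \<open>u a\<close> by exactly 1 on the preimage of
  \<open>F\<close>, so a strict sublevel set of \<open>u\<close> is a neighbourhood of
  \<open>a\<close> missing that preimage. A continuous bijection from a compact to a Hausdorff space
  is a homeomorphism.\<close>

lemma osc_corr_point_map_homeomorphic:
  assumes "osc_corr K L R" "compact_space K" "compact_space L" "Hausdorff_space L"
    and inj: "inj_on \<sigma> (topspace K)" and surj: "\<sigma> ` topspace K = topspace L"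
    and peak: "\<And>x y u w. x \<in> topspace K \<Longrightarrow> y \<in> topspace K \<Longrightarrow> x \<noteq> y \<Longrightarrow> R u w \<Longrightarrow>
      peak K u x y \<longleftrightarrow> peak L w (\<sigma> x) (\<sigma> y)"
  shows "K homeomorphic_space L"
proof -
  have "continuous_map K L \<sigma>"
    unfolding continuous_map_closedin
  proof (intro conjI allI impI)
    show "\<sigma> \<in> topspace K \<rightarrow> topspace L"
      using surj by blast
    fix F assume F: "closedin L F"
    have "openin K (topspace K - {x \<in> topspace K. \<sigma> x \<in> F})"
    proof (subst openin_subopen, intro ballI)
      fix a assume a: "a \<in> topspace K - {x \<in> topspace K. \<sigma> x \<in> F}"
      show "\<exists>T. openin K T \<and> a \<in> T \<and> T \<subseteq> topspace K - {x \<in> topspace K. \<sigma> x \<in> F}"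
      proof (cases "F = {}")
        case True
        then show ?thesis using a by auto
      next
        case False
        then obtain b where b: "b \<in> topspace K" "\<sigma> b \<in> F"
          using surj closedin_subset[OF F] by (metis ex_in_conv imageE subsetD)
        have "closedin L {\<sigma> a}" "F \<inter> {\<sigma> a} = {}"
          using a assms(4) surj by (auto simp: closedin_Hausdorff_sing_eq)
        then obtain w where w: "continuous_map L euclideanreal w" "osc L w = 1"
          "\<And>p. p \<in> F \<Longrightarrow> peak L w p (\<sigma> a)"
          using separating_function[OF assms(3,4) F, of "{\<sigma> a}"] False by (metis empty_not_insert insertI1)
        obtain u where u: "R u w"
          using osc_corrD(5)[OF assms(1), OF w(1)] by blast
        have *: "u x - u a = 1" if "x \<in> topspace K" "\<sigma> x \<in> F" for x
        proof -
          have "peak K u x a"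
            using peak[OF _ _ _ u] w(3) that a by blast
          then show ?thesis
            using osc_corrD(3)[OF assms(1), OF u] w(2) by (simp add: peak_def)
        qed
        have "openin K {x \<in> topspace K. u x \<in> {..<u b}}"
          using openin_continuous_map_preimage[OF osc_corrD(1)[OF assms(1), OF u]] by (metis open_lessThan open_openin)
        moreover have "u a < u b"
          using *[OF b] by simp
        moreover have "\<not> u x < u b" if "x \<in> topspace K" "\<sigma> x \<in> F" for x
          using *[OF b] *[OF that] by simp
        ultimately show ?thesis
          using a by (intro exI[of _ "{x \<in> topspace K. u x \<in> {..<u b}}"]) auto
      qed
    qed
    then show "closedin K {x \<in> topspace K. \<sigma> x \<in> F}"
      by (simp add: closedin_def)
  qed
  then have "homeomorphic_map K L \<sigma>"
    using continuous_imp_homeomorphic_map assms(2,4) inj surj by blast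
  then show ?thesis
    using homeomorphic_map_imp_homeomorphic_space by blast
qed

text \<open>The bijection of pairs is \<open>(x, y) \<mapsto> (P x y, P y x)\<close>. Incidence of
  pairs shows that \<open>P x y\<close> depends only on \<open>x\<close> or only on
  \<open>y\<close>; the second case becomes the first after negation. A one-point \<open>K\<close>
  has no pairs and is treated separately.\<close>

theorem osc_corr_imp_homeomorphic:
  assumes R: "osc_corr K L R" and K: "compact_space K" "Hausdorff_space K" "topspace K \<noteq> {}"
    and L: "compact_space L" "Hausdorff_space L" "topspace L \<noteq> {}"
  shows "K homeomorphic_space L"
proof (cases "\<exists>a\<in>topspace K. \<exists>b\<in>topspace K. a \<noteq> b")
  case False
  have single_L: "p = q" if pq: "p \<in> topspace L" "q \<in> topspace L" for p q
  proof (rule ccontr)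
    assume "p \<noteq> q"
    obtain x y where "x \<in> topspace K" "y \<in> topspace K" "x \<noteq> y"
      by (rule osc_corr_peak_iff[OF osc_corr_conversep[OF R] L K pq \<open>p \<noteq> q\<close>]) (rule that)
    then show False
      using False by blast
  qed
  obtain p where p: "p \<in> topspace L"
    using L(3) by blast
  show ?thesis
  proof (rule osc_corr_point_map_homeomorphic[OF R K(1) L(1,2), of "\<lambda>_. p"])
    show "inj_on (\<lambda>_. p) (topspace K)"
      using False by (auto simp: inj_on_def)
    show "(\<lambda>_. p) ` topspace K = topspace L"
    proof -
      have "topspace L = {p}"
        using p single_L by blast
      then show ?thesis
        using K(3) by (metis image_constant_conv)
    qed
  qed (use p False in auto)
next
  case True
  define G where "G R' x y p q \<longleftrightarrow> (\<forall>u w. R' u w \<longrightarrow> (peak K u x y \<longleftrightarrow> peak L w p q))"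
    for R' :: "('a \<Rightarrow> real) \<Rightarrow> ('b \<Rightarrow> real) \<Rightarrow> bool" and x y p q
  have "\<exists>p q. p \<in> topspace L \<and> q \<in> topspace L \<and> p \<noteq> q \<and> G R x y p q"
    if xy: "x \<in> topspace K" "y \<in> topspace K" "x \<noteq> y" for x y
  proof -
    obtain p q where "p \<in> topspace L" "q \<in> topspace L" "p \<noteq> q"
      "\<And>u w. R u w \<Longrightarrow> peak K u x y \<longleftrightarrow> peak L w p q"
      by (rule osc_corr_peak_iff[OF R K L xy]) (rule that)
    then show ?thesis
      unfolding G_def by blast
  qed
  then obtain P Q where PQ: "P x y \<in> topspace L \<and> Q x y \<in> topspace L \<and> P x y \<noteq> Q x y \<and> G R x y (P x y) (Q x y)"
    if "x \<in> topspace K" "y \<in> topspace K" "x \<noteq> y" for x y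
    by metis
  have unique: "p = p' \<and> q = q'" if "G R x y p q" "G R x y p' q'" "p \<in> topspace L" "q \<in> topspace L"
      "p \<noteq> q" "p' \<in> topspace L" "q' \<in> topspace L" for x y p q p' q'
  proof (rule peak_unique[OF L(1,2) that(3-7)])
    fix w assume w: "continuous_map L euclideanreal w" "peak L w p q"
    obtain u where u: "R u w"
      using osc_corrD(5)[OF R, OF w(1)] by blast
    show "peak L w p' q'"
      using that(1,2) u w(2) unfolding G_def by blast
  qed
  \<comment> \<open>Negating both related functions reverses their peak pairs, so reversed pairs
    correspond to reversed pairs. With uniqueness this makes \<open>P\<close> alone
    sufficient.\<close>
  have swap: "G R y x q p" if "G R x y p q" for x y p q
    unfolding G_def
  proof (intro allI impI)
    fix u w assume uw: "R u w"
    have "peak K (\<lambda>x. - u x) x y \<longleftrightarrow> peak L (\<lambda>x. - w x) p q"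
      using that osc_corrD(7)[OF R, OF uw] unfolding G_def by blast
    then show "peak K u y x \<longleftrightarrow> peak L w q p"
      using osc_minus[OF K(1,3) osc_corrD(1)[OF R, OF uw]] osc_minus[OF L(1,3) osc_corrD(2)[OF R, OF uw]]
      by (simp add: peak_def algebra_simps)
  qed
  have QP: "Q x y = P y x" if "x \<in> topspace K" "y \<in> topspace K" "x \<noteq> y" for x y
    using unique[OF swap, of x y "P x y" "Q x y" "P y x" "Q y x"] PQ[OF that] PQ[of y x] that by auto
  have P: "P x y \<in> topspace L" "P x y \<noteq> P y x" "G R x y (P x y) (P y x)"
    if "x \<in> topspace K" "y \<in> topspace K" "x \<noteq> y" for x y
    using PQ[OF that] QP[OF that] by auto
  \<comment> \<open>A nonconstant common peak function passes along \<open>R\<close> in both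
    directions, so \<open>common_peak_function_iff\<close> can be applied in \<open>K\<close> and in
    \<open>L\<close>.\<close>
  have compose: "(x = y' \<or> y = x') \<longleftrightarrow> (P x y = P y' x' \<or> P y x = P x' y')"
    if xy: "x \<in> topspace K" "y \<in> topspace K" "x \<noteq> y" and xy': "x' \<in> topspace K" "y' \<in> topspace K" "x' \<noteq> y'"
    for x y x' y'
  proof -
    have "(\<exists>u. continuous_map K euclideanreal u \<and> osc K u \<noteq> 0 \<and> peak K u x y \<and> peak K u x' y') \<longleftrightarrow>
      (\<exists>w. continuous_map L euclideanreal w \<and> osc L w \<noteq> 0 \<and> peak L w (P x y) (P y x) \<and> peak L w (P x' y') (P y' x'))"
      (is "?l \<longleftrightarrow> ?r")
    proof
      assume ?l
      then obtain u where u: "continuous_map K euclideanreal u" "osc K u \<noteq> 0" "peak K u x y" "peak K u x' y'"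
        by blast
      obtain w where w: "R u w"
        using osc_corrD(4)[OF R, OF u(1)] by blast
      have "peak L w (P x y) (P y x)" "peak L w (P x' y') (P y' x')"
        using P(3)[OF xy] P(3)[OF xy'] u(3,4) w unfolding G_def by blast+
      then show ?r
        using osc_corrD(2,3)[OF R, OF w] u(2) by auto
    next
      assume ?r
      then obtain w where w: "continuous_map L euclideanreal w" "osc L w \<noteq> 0"
        "peak L w (P x y) (P y x)" "peak L w (P x' y') (P y' x')"
        by blast
      obtain u where u: "R u w"
        using osc_corrD(5)[OF R, OF w(1)] by blast
      have "peak K u x y" "peak K u x' y'"
        using P(3)[OF xy] P(3)[OF xy'] w(3,4) u unfolding G_def by blast+
      then show ?l
        using osc_corrD(1,3)[OF R, OF u] w(2) by auto
    qed
    also have "?r \<longleftrightarrow> P x y \<noteq> P y' x' \<and> P y x \<noteq> P x' y'"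
      using P xy xy' by (intro common_peak_function_iff[OF L(1,2)]) auto
    finally show ?thesis
      using common_peak_function_iff[OF K(1,2) xy xy'] by blast
  qed
  \<comment> \<open>For surjectivity, complete \<open>p\<close> to a pair of distinct points of
    \<open>L\<close> and pull that pair back.\<close>
  have hit: "\<exists>x\<in>topspace K. \<exists>y\<in>topspace K. x \<noteq> y \<and> P x y = p" if p: "p \<in> topspace L" for p
  proof -
    obtain q where q: "q \<in> topspace L" "p \<noteq> q"
      using True P p by metis
    obtain x y where xy: "x \<in> topspace K" "y \<in> topspace K" "x \<noteq> y"
      and pk: "\<And>w u. R u w \<Longrightarrow> peak L w p q \<longleftrightarrow> peak K u x y"
      by (rule osc_corr_peak_iff[OF osc_corr_conversep[OF R] L K p q]) (rule that)
    have "G R x y p q"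
      using pk unfolding G_def by blast
    then have "p = P x y"
      using unique[OF _ P(3)[OF xy]] P(1,2)[OF xy] P(1)[OF xy(2,1)] p q xy(3) by auto
    then show ?thesis
      using xy by blast
  qed
  \<comment> \<open>Stated for general \<open>R'\<close> and \<open>P'\<close> so that it serves
    both \<open>R\<close> with \<open>P\<close> and the negated correspondence with the arguments of
    \<open>P\<close> exchanged.\<close>
  have point_map: ?thesis
    if R': "osc_corr K L R'"
      and row: "\<forall>x\<in>topspace K. \<forall>y\<in>topspace K. \<forall>z\<in>topspace K. x \<noteq> y \<longrightarrow> x \<noteq> z \<longrightarrow> P' x y = P' x z"
      and P': "\<And>x y. x \<in> topspace K \<Longrightarrow> y \<in> topspace K \<Longrightarrow> x \<noteq> y \<Longrightarrow>
        P' x y \<in> topspace L \<and> P' x y \<noteq> P' y x \<and> G R' x y (P' x y) (P' y x)"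
      and hit': "\<And>p. p \<in> topspace L \<Longrightarrow> \<exists>x\<in>topspace K. \<exists>y\<in>topspace K. x \<noteq> y \<and> P' x y = p"
    for R' P'
  proof -
    define \<sigma> where "\<sigma> x = P' x (SOME y. y \<in> topspace K \<and> x \<noteq> y)" for x
    have \<sigma>: "\<sigma> x = P' x y" if "x \<in> topspace K" "y \<in> topspace K" "x \<noteq> y" for x y
    proof -
      have "(SOME y. y \<in> topspace K \<and> x \<noteq> y) \<in> topspace K \<and> x \<noteq> (SOME y. y \<in> topspace K \<and> x \<noteq> y)"
        by (rule someI[of _ y]) (use that in auto)
      then show ?thesis
        unfolding \<sigma>_def using row that by metis
    qed
    have mem: "\<sigma> x \<in> topspace L" if "x \<in> topspace K" for x
      using \<sigma> P' that True by metis
    show ?thesis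
    proof (rule osc_corr_point_map_homeomorphic[OF R' K(1) L(1,2)])
      show "inj_on \<sigma> (topspace K)"
        unfolding inj_on_def using \<sigma> P' by metis
      show "peak K u x y \<longleftrightarrow> peak L w (\<sigma> x) (\<sigma> y)"
        if "x \<in> topspace K" "y \<in> topspace K" "x \<noteq> y" "R' u w" for x y u w
        using P'[OF that(1-3)] \<sigma>[OF that(1-3)] \<sigma>[OF that(2,1)] that unfolding G_def by auto
      show "\<sigma> ` topspace K = topspace L"
      proof
        show "topspace L \<subseteq> \<sigma> ` topspace K"
        proof
          fix p assume "p \<in> topspace L"
          then obtain x y where "x \<in> topspace K" "y \<in> topspace K" "x \<noteq> y" "P' x y = p"
            using hit' by blast
          then show "p \<in> \<sigma> ` topspace K"
            using \<sigma> by (intro image_eqI[of _ _ x]) auto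
        qed
      qed (use mem in blast)
    qed
  qed
  have "(\<forall>x\<in>topspace K. \<forall>y\<in>topspace K. \<forall>z\<in>topspace K. x \<noteq> y \<longrightarrow> x \<noteq> z \<longrightarrow> P x y = P x z) \<or>
        (\<forall>x\<in>topspace K. \<forall>y\<in>topspace K. \<forall>z\<in>topspace K. x \<noteq> y \<longrightarrow> x \<noteq> z \<longrightarrow> P y x = P z x)"
  proof (rule rows_or_columns)
    fix x y x' y' assume *: "x \<in> topspace K" "y \<in> topspace K" "x \<noteq> y" "x' \<in> topspace K" "y' \<in> topspace K" "x' \<noteq> y'"
    show "(x = x' \<or> y = y') \<longleftrightarrow> (P x y = P x' y' \<or> P y x = P y' x')"
      \<comment> \<open>Reversing the second pair turns "begins where the other ends" into "shares a
        first or a second entry".\<close>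
      using compose[OF *(1-3) *(5,4)] *(6) by auto
  qed (use P in blast)
  then show ?thesis
  proof
    assume "\<forall>x\<in>topspace K. \<forall>y\<in>topspace K. \<forall>z\<in>topspace K. x \<noteq> y \<longrightarrow> x \<noteq> z \<longrightarrow> P x y = P x z"
    from point_map[OF R this] show ?thesis
      using P hit by blast
  next
    assume col: "\<forall>x\<in>topspace K. \<forall>y\<in>topspace K. \<forall>z\<in>topspace K. x \<noteq> y \<longrightarrow> x \<noteq> z \<longrightarrow> P y x = P z x"
    have "G (\<lambda>u w. R u (\<lambda>x. - w x)) x y (P y x) (P x y)" if xy: "x \<in> topspace K" "y \<in> topspace K" "x \<noteq> y" for x y
      unfolding G_def
    proof (intro allI impI)
      fix u w assume uw: "R u (\<lambda>x. - w x)"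
      then have "continuous_map L euclideanreal w"
        using osc_corrD(2)[OF R, OF uw] by simp
      then show "peak K u x y \<longleftrightarrow> peak L w (P y x) (P x y)"
        using P(3)[OF xy] uw osc_minus[OF L(1,3)] by (auto simp: G_def peak_def algebra_simps)
    qed
    moreover have "\<exists>x\<in>topspace K. \<exists>y\<in>topspace K. x \<noteq> y \<and> P y x = p" if p: "p \<in> topspace L" for p
    proof -
      obtain x y where "x \<in> topspace K" "y \<in> topspace K" "x \<noteq> y" "P x y = p"
        using hit[OF p] by blast
      then show ?thesis
        by (intro bexI[of _ y] bexI[of _ x]) auto
    qed
    moreover have "P y x \<in> topspace L \<and> P y x \<noteq> P x y"
      if "x \<in> topspace K" "y \<in> topspace K" "x \<noteq> y" for x y
      using P(1,2)[of y x] that by auto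
    ultimately show ?thesis
      by (intro point_map[OF osc_corr_minus[OF R L(1,3)] col]) auto
  qed
qed

section \<open>Isometries preserve midpoints\<close>

definition metric_on :: "'a set \<Rightarrow> ('a \<Rightarrow> 'a \<Rightarrow> real) \<Rightarrow> bool" where
  "metric_on X d \<longleftrightarrow> (\<forall>x\<in>X. \<forall>y\<in>X. d x y = d y x \<and> (d x y = 0 \<longleftrightarrow> x = y) \<and> (\<forall>z\<in>X. d x z \<le> d x y + d y z))"

definition isometry_onto :: "'a set \<Rightarrow> ('a \<Rightarrow> 'a \<Rightarrow> real) \<Rightarrow> 'b set \<Rightarrow> ('b \<Rightarrow> 'b \<Rightarrow> real) \<Rightarrow> ('a \<Rightarrow> 'b) \<Rightarrow> bool" where
  "isometry_onto X dX Y dY T \<longleftrightarrow> T ` X = Y \<and> (\<forall>x\<in>X. \<forall>y\<in>X. dY (T x) (T y) = dX x y)"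

text \<open>An abstract form of the map sending x to 2z - x in a normed space. The last identity
  supplies the doubling on which the midpoint argument rests.\<close>

definition point_reflection :: "'a set \<Rightarrow> ('a \<Rightarrow> 'a \<Rightarrow> real) \<Rightarrow> 'a \<Rightarrow> ('a \<Rightarrow> 'a) \<Rightarrow> bool" where
  "point_reflection X d z \<rho> \<longleftrightarrow> z \<in> X \<and> \<rho> z = z \<and> isometry_onto X d X d \<rho> \<and>
     (\<forall>x\<in>X. \<rho> (\<rho> x) = x \<and> d (\<rho> x) x = 2 * d x z)"

lemma isometry_onto_inv_into:
  assumes "metric_on X dX" "metric_on Y dY" "isometry_onto X dX Y dY T"
  shows "inj_on T X" "isometry_onto Y dY X dX (inv_into X T)"
proof -
  have T: "T ` X = Y" "\<And>x y. x \<in> X \<Longrightarrow> y \<in> X \<Longrightarrow> dY (T x) (T y) = dX x y"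
    using assms(3) by (auto simp: isometry_onto_def)
  show inj: "inj_on T X"
  proof (rule inj_onI)
    fix x y assume xy: "x \<in> X" "y \<in> X" "T x = T y"
    then have "dY (T x) (T y) = 0"
      using assms(2) T(1) by (auto simp: metric_on_def)
    then have "dX x y = 0"
      using T(2)[OF xy(1,2)] by simp
    then show "x = y"
      using assms(1) xy unfolding metric_on_def by blast
  qed
  have "inv_into X T ` Y = X"
    using inj T(1) by (metis inv_into_image_cancel subset_refl)
  moreover have "dX (inv_into X T x) (inv_into X T y) = dY x y" if "x \<in> Y" "y \<in> Y" for x y
    using T that by (metis f_inv_into_f inv_into_into)
  ultimately show "isometry_onto Y dY X dX (inv_into X T)"
    by (simp add: isometry_onto_def)
qed

lemma isometry_onto_comp:
  assumes "isometry_onto X dX Y dY S" "isometry_onto Y dY Z dZ T"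
  shows "isometry_onto X dX Z dZ (\<lambda>x. T (S x))"
proof -
  have "(\<lambda>x. T (S x)) ` X = T ` S ` X"
    by (simp add: image_image)
  moreover have "S x \<in> Y" if "x \<in> X" for x
    using assms(1) that by (auto simp: isometry_onto_def)
  ultimately show ?thesis
    using assms by (simp add: isometry_onto_def)
qed

text \<open>
  Vaisala's device for the Mazur--Ulam theorem: this composition doubles the distance by which
  \<open>T\<close> fails to map the centre \<open>z\<close> to the centre \<open>z'\<close>, while still fixing \<open>a\<close> and \<open>b\<close>.
\<close>

lemma reflected_commutator:
  assumes X: "metric_on X dX" and Y: "metric_on Y dY" and T: "isometry_onto X dX Y dY T"
    and \<rho>: "point_reflection X dX z \<rho>" and \<rho>': "point_reflection Y dY z' \<rho>'"
    and ab: "a \<in> X" "b \<in> X" "\<rho> a = b" and ab': "T a = a'" "T b = b'" "\<rho>' a' = b'"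
  defines "S \<equiv> (\<lambda>x. \<rho> (inv_into X T (\<rho>' (T x))))"
  shows "isometry_onto X dX X dX S" "S a = a" "S b = b" "dX (S z) z = 2 * dY (T z) z'"
proof -
  note inv = isometry_onto_inv_into[OF X Y T]
  have Tim: "T ` X = Y"
    using T by (simp add: isometry_onto_def)
  have i: "isometry_onto X dX X dX \<rho>" "isometry_onto Y dY Y dY \<rho>'"
    using \<rho> \<rho>' by (auto simp: point_reflection_def)
  show "isometry_onto X dX X dX S"
    unfolding S_def
    by (rule isometry_onto_comp[OF isometry_onto_comp[OF isometry_onto_comp[OF T i(2)] inv(2)] i(1)])
  \<comment> \<open>Both reflections are involutions, so they swap \<open>a\<close> with
    \<open>b\<close> and \<open>a'\<close> with \<open>b'\<close>; hence the two swaps in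
    \<open>S\<close> cancel at \<open>a\<close> and at \<open>b\<close>.\<close>
  have "\<rho> (\<rho> a) = a" "\<rho>' (\<rho>' (T a)) = T a"
    using \<rho> \<rho>' ab(1) Tim unfolding point_reflection_def by blast+
  then have "\<rho> b = a" "\<rho>' b' = a'"
    using ab ab' by simp_all
  then show "S a = a" "S b = b"
    using ab ab' inv(1) by (auto simp: S_def inv_into_f_eq)
  have z: "z \<in> X" "\<rho> z = z"
    using \<rho> by (auto simp: point_reflection_def)
  then have Tz: "T z \<in> Y" "\<rho>' (T z) \<in> Y"
    using Tim i(2) by (auto simp: isometry_onto_def)
  define y where "y = inv_into X T (\<rho>' (T z))"
  have y: "y \<in> X" "T y = \<rho>' (T z)"
    using Tz Tim by (auto simp: y_def inv_into_into f_inv_into_f)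
  have "dX (S z) z = dX (\<rho> y) (\<rho> z)"
    using z by (simp add: S_def y_def)
  also have "\<dots> = dX y z"
    using i(1) y(1) z(1) unfolding isometry_onto_def by blast
  also have "\<dots> = dY (T y) (T z)"
    using T y(1) z(1) by (simp add: isometry_onto_def)
  also have "\<dots> = 2 * dY (T z) z'"
    using \<rho>' y Tz by (simp add: point_reflection_def)
  finally show "dX (S z) z = 2 * dY (T z) z'" .
qed

text \<open>Isometries of \<open>X\<close> fixing \<open>a\<close> and \<open>b\<close> move
  \<open>z\<close> by at most \<open>2 * dX a z\<close>. Since commutators with the reflection
  double the displacement indefinitely, it must be 0.\<close>

lemma isometry_preserves_reflection_centre:
  assumes X: "metric_on X dX" and Y: "metric_on Y dY" and T: "isometry_onto X dX Y dY T"
    and \<rho>: "point_reflection X dX z \<rho>" and \<rho>': "point_reflection Y dY z' \<rho>'"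
    and ab: "a \<in> X" "b \<in> X" "\<rho> a = b" and ab': "T a = a'" "T b = b'" "\<rho>' a' = b'"
  shows "T z = z'"
proof -
  have z: "z \<in> X" "z' \<in> Y"
    using \<rho> \<rho>' by (auto simp: point_reflection_def)
  \<comment> \<open>The isometry \<open>g\<close> varies in the induction: the step applies the
    hypothesis to its commutator with \<open>\<rho>\<close>, which moves \<open>z\<close> twice as
    far.\<close>
  have bound: "2 ^ n * dX (g z) z \<le> 2 * dX a z"
    if "isometry_onto X dX X dX g" "g a = a" "g b = b" for g n
    using that
  proof (induction n arbitrary: g)
    case 0
    have gz: "g z \<in> X" "dX (g z) (g a) = dX z a"
      using 0(1) z ab(1) by (auto simp: isometry_onto_def)
    have "dX (g z) z \<le> dX (g z) a + dX a z" "dX z a = dX a z"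
      using X gz(1) z(1) ab(1) unfolding metric_on_def by blast+
    with gz(2) 0(2) show ?case by simp
  next
    case (Suc n)
    note * = reflected_commutator[OF X X Suc.prems(1) \<rho> \<rho> ab Suc.prems(2,3) ab(3)]
    show ?case
      using Suc.IH[OF *(1-3)] unfolding *(4) by simp
  qed
  \<comment> \<open>The commutator built from \<open>T\<close> is a self-isometry of
    \<open>X\<close> fixing \<open>a\<close> and \<open>b\<close>, and it moves \<open>z\<close> by
    twice the distance from \<open>T z\<close> to \<open>z'\<close>.\<close>
  note * = reflected_commutator[OF X Y T \<rho> \<rho>' ab ab']
  define t where "t = dY (T z) z'"
  have "2 ^ n * (2 * t) \<le> 2 * dX a z" for n
    using bound[OF *(1-3), of n] unfolding *(4) t_def .
  then have le: "2 ^ n * t \<le> dX a z" for n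
    by (metis mult.left_commute mult_le_cancel_left_pos zero_less_numeral)
  have "t \<le> 0"
  proof (rule ccontr)
    assume "\<not> t \<le> 0"
    obtain n where "dX a z / t < 2 ^ n"
      using real_arch_pow[of 2 "dX a z / t"] by auto
    then show False
      using le[of n] \<open>\<not> t \<le> 0\<close> by (simp add: field_simps)
  qed
  moreover have Tz: "T z \<in> Y"
    using T z(1) by (auto simp: isometry_onto_def)
  moreover have "0 \<le> t"
  proof -
    have "dY (T z) (T z) \<le> dY (T z) z' + dY z' (T z)" "dY (T z) (T z) = 0" "dY z' (T z) = dY (T z) z'"
      using Y Tz z(2) unfolding metric_on_def by blast+
    then show ?thesis by (simp add: t_def)
  qed
  ultimately show ?thesis
    using Y z(2) by (auto simp: t_def metric_on_def)
qed

section \<open>Logarithmic coordinates on the simplex\<close>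

text \<open>As \<open>ln\<close> is increasing, a maximum point of the difference of logarithms
  maximises \<open>f / g\<close>, and this positive maximum is the least admissible factor.\<close>

lemma hilbert_M_eqI:
  assumes "x \<in> topspace K" "\<And>z. z \<in> topspace K \<Longrightarrow> 0 < f z" "\<And>z. z \<in> topspace K \<Longrightarrow> 0 < g z"
    and "\<And>z. z \<in> topspace K \<Longrightarrow> ln (f z) - ln (g z) \<le> ln (f x) - ln (g x)"
  shows "hilbert_M K f g = f x / g x"
  unfolding hilbert_M_def
proof (rule cInf_eq_minimum)
  have "f z / g z \<le> f x / g x" if "z \<in> topspace K" for z
  proof -
    note pos = assms(2,3)[OF that] assms(2,3)[OF assms(1)]
    have "ln (f z / g z) \<le> ln (f x / g x)"
      using assms(4)[OF that] pos by (simp add: ln_div)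
    then show ?thesis
      using pos by (subst (asm) ln_le_cancel_iff) auto
  qed
  then show "f x / g x \<in> {\<beta>. 0 < \<beta> \<and> (\<forall>z\<in>topspace K. f z \<le> \<beta> * g z)}"
    using assms(1-3) by (auto simp: pos_divide_le_eq)
next
  fix \<beta> assume "\<beta> \<in> {\<beta>. 0 < \<beta> \<and> (\<forall>z\<in>topspace K. f z \<le> \<beta> * g z)}"
  then show "f x / g x \<le> \<beta>"
    using assms(1,3) by (simp add: pos_divide_le_eq)
qed

lemma continuous_map_ln:
  assumes "continuous_map K euclideanreal f" "\<And>x. x \<in> topspace K \<Longrightarrow> 0 < f x"
  shows "continuous_map K euclideanreal (\<lambda>x. ln (f x))"
proof -
  have "continuous_map K (top_of_set {0<..}) f"
    using assms by (auto simp: continuous_map_in_subtopology)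
  moreover have "continuous_map (top_of_set {0<..}) euclideanreal ln"
    by (auto intro!: continuous_intros)
  ultimately show ?thesis
    by (rule continuous_map_compose[unfolded o_def])
qed

lemma continuous_map_exp:
  "continuous_map K euclideanreal u \<Longrightarrow> continuous_map K euclideanreal (\<lambda>x. exp (u x :: real))"
  by (rule continuous_map_compose[of _ euclideanreal _ _ exp, unfolded o_def]) (auto intro!: continuous_intros)

text \<open>The two factors are the values of \<open>f / g\<close> at a maximum point and of
  \<open>g / f\<close> at a minimum point of the log-ratio; the logarithm of their product is the
  difference of its extreme values.\<close>

lemma hilbert_dist_eq_osc:
  assumes "compact_space K" "topspace K \<noteq> {}"
    and "continuous_map K euclideanreal f" "\<And>z. z \<in> topspace K \<Longrightarrow> 0 < f z"
    and "continuous_map K euclideanreal g" "\<And>z. z \<in> topspace K \<Longrightarrow> 0 < g z"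
  shows "hilbert_dist K f g = osc K (\<lambda>x. ln (f x) - ln (g x))"
proof -
  have "continuous_map K euclideanreal (\<lambda>x. ln (f x) - ln (g x))"
    using assms by (intro continuous_map_diff continuous_map_ln)
  from continuous_map_attains_bounds[OF assms(1,2) this]
  obtain x y where xy: "x \<in> topspace K" "y \<in> topspace K"
    and x: "\<And>z. z \<in> topspace K \<Longrightarrow> ln (f z) - ln (g z) \<le> ln (f x) - ln (g x)"
    and y: "\<And>z. z \<in> topspace K \<Longrightarrow> ln (f y) - ln (g y) \<le> ln (f z) - ln (g z)"
    by blast
  have "hilbert_M K f g = f x / g x" "hilbert_M K g f = g y / f y"
    using xy x y assms(4,6) by (auto intro!: hilbert_M_eqI) (smt (verit))
  moreover have "ln (f x / g x * (g y / f y)) = (ln (f x) - ln (g x)) - (ln (f y) - ln (g y))"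
    using xy assms(4,6)[of x] assms(4,6)[of y] by (simp add: ln_mult ln_div)
  ultimately show ?thesis
    using osc_eqI[OF xy x y] by (simp add: hilbert_dist_def)
qed

section \<open>Normalized exponentials and reflections of the simplex\<close>

locale positive_measure_on_compact =
  fixes K :: "'a topology" and \<mu> :: "'a measure"
  assumes compact: "compact_space K" and nonempty: "topspace K \<noteq> {}"
    and borel: "borel_measure_on K \<mu>" and finite: "finite_measure \<mu>"
    and strictly_positive: "strictly_positive_on K \<mu>"
begin

text \<open>The Gibbs density of \<open>u\<close>: an inverse of the logarithm modulo constants.
  Restriction gives the extensional representative demanded by \<open>cont_funs\<close>.\<close>

definition normalized_exp :: "('a \<Rightarrow> real) \<Rightarrow> 'a \<Rightarrow> real" where
  "normalized_exp u = restrict (\<lambda>x. exp (u x) / (\<integral>y. exp (u y) \<partial>\<mu>)) (topspace K)"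

lemma integral_restrict: "(\<integral>x. restrict f (topspace K) x \<partial>\<mu>) = (\<integral>x. f x \<partial>\<mu>)"
  for f :: "'a \<Rightarrow> real"
  using borel_measure_on_space[OF borel] by (intro Bochner_Integration.integral_cong) auto

lemma integral_exp_pos:
  assumes "continuous_map K euclideanreal u"
  shows "0 < (\<integral>x. exp (u x) \<partial>\<mu>)"
proof -
  let ?f = "restrict (\<lambda>x. exp (u x)) (topspace K)"
  have "?f \<in> cont_funs K"
    using continuous_map_exp[OF assms] by (auto simp: cont_funs_def elim: continuous_map_eq)
  moreover obtain x where "x \<in> topspace K"
    using nonempty by blast
  then have "\<exists>x\<in>topspace K. ?f x \<noteq> 0" "\<forall>x\<in>topspace K. 0 \<le> ?f x"
    by auto
  ultimately have "0 < (\<integral>x. ?f x \<partial>\<mu>)"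
    using strictly_positive unfolding strictly_positive_on_def by blast
  then show ?thesis
    by (simp only: integral_restrict)
qed

lemma normalized_exp_mem:
  assumes "continuous_map K euclideanreal u"
  shows "normalized_exp u \<in> simplex_interior K \<mu>"
proof -
  let ?c = "\<integral>y. exp (u y) \<partial>\<mu>"
  have c: "0 < ?c"
    by (rule integral_exp_pos[OF assms])
  have "continuous_map K euclideanreal (\<lambda>x. exp (u x) / ?c)"
    using c by (intro continuous_map_real_divide continuous_map_exp[OF assms]) auto
  then have "normalized_exp u \<in> cont_funs K"
    by (auto simp: cont_funs_def normalized_exp_def elim: continuous_map_eq)
  moreover have "(\<integral>x. normalized_exp u x \<partial>\<mu>) = 1"
    using c unfolding normalized_exp_def integral_restrict by simp
  moreover have "\<forall>x\<in>topspace K. 0 < normalized_exp u x"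
    using c by (simp add: normalized_exp_def)
  ultimately show ?thesis
    by (simp add: simplex_interior_def)
qed

lemma ln_normalized_exp:
  assumes "continuous_map K euclideanreal u" "x \<in> topspace K"
  shows "ln (normalized_exp u x) = u x - ln (\<integral>y. exp (u y) \<partial>\<mu>)"
  using integral_exp_pos[OF assms(1)] assms(2) by (simp add: normalized_exp_def ln_div)

lemma simplex_interiorD:
  assumes "f \<in> simplex_interior K \<mu>"
  shows "continuous_map K euclideanreal f" "x \<in> topspace K \<Longrightarrow> 0 < f x"
    "continuous_map K euclideanreal (\<lambda>x. ln (f x))"
  using assms by (auto simp: simplex_interior_def cont_funs_def intro: continuous_map_ln)

lemma normalized_exp_ln:
  assumes "f \<in> simplex_interior K \<mu>"
  shows "normalized_exp (\<lambda>x. ln (f x)) = f"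
proof -
  have "(\<integral>x. exp (ln (f x)) \<partial>\<mu>) = (\<integral>x. f x \<partial>\<mu>)"
    using borel_measure_on_space[OF borel] simplex_interiorD(2)[OF assms]
    by (intro Bochner_Integration.integral_cong) auto
  then have "(\<integral>x. exp (ln (f x)) \<partial>\<mu>) = 1"
    using assms by (simp add: simplex_interior_def)
  moreover have "f \<in> extensional (topspace K)"
    using assms by (simp add: simplex_interior_def cont_funs_def)
  ultimately show ?thesis
    using simplex_interiorD(2)[OF assms]
    by (intro extensionalityI[of _ "topspace K"]) (auto simp: normalized_exp_def)
qed

text \<open>Normalization only shifts the logarithm by a constant, which \<open>osc\<close> does not
  see.\<close>

lemma hilbert_dist_normalized_exp:
  assumes "continuous_map K euclideanreal u" "continuous_map K euclideanreal v"
  shows "hilbert_dist K (normalized_exp u) (normalized_exp v) = osc K (\<lambda>x. u x - v x)"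
proof -
  note u = simplex_interiorD[OF normalized_exp_mem[OF assms(1)]]
    and v = simplex_interiorD[OF normalized_exp_mem[OF assms(2)]]
  have "hilbert_dist K (normalized_exp u) (normalized_exp v) =
      osc K (\<lambda>x. ln (normalized_exp u x) - ln (normalized_exp v x))"
    using u v by (intro hilbert_dist_eq_osc compact nonempty)
  also have "\<dots> = osc K (\<lambda>x. u x - v x)"
    by (rule osc_cong[where c = "ln (\<integral>y. exp (v y) \<partial>\<mu>) - ln (\<integral>y. exp (u y) \<partial>\<mu>)"])
      (use assms ln_normalized_exp in simp)
  finally show ?thesis .
qed

lemma normalized_exp_cong:
  assumes "\<And>x. x \<in> topspace K \<Longrightarrow> u x = v x + c"
  shows "normalized_exp u = normalized_exp v"
proof -
  have "(\<integral>x. exp (u x) \<partial>\<mu>) = (\<integral>x. exp c * exp (v x) \<partial>\<mu>)"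
    using borel_measure_on_space[OF borel] assms
    by (intro Bochner_Integration.integral_cong) (auto simp: exp_add)
  then show ?thesis
    unfolding normalized_exp_def by (intro restrict_ext) (simp add: assms exp_add)
qed

lemma normalized_exp_eq_iff:
  assumes "continuous_map K euclideanreal u" "continuous_map K euclideanreal v"
  shows "normalized_exp u = normalized_exp v \<longleftrightarrow> osc K (\<lambda>x. u x - v x) = 0"
proof
  assume "normalized_exp u = normalized_exp v"
  then have "osc K (\<lambda>x. u x - v x) = osc K (\<lambda>x. v x - v x)"
    using hilbert_dist_normalized_exp assms by metis
  also have "\<dots> = 0"
    using nonempty by (auto simp: osc_def)
  finally show "osc K (\<lambda>x. u x - v x) = 0" .
next
  assume "osc K (\<lambda>x. u x - v x) = 0"
  then obtain c where "\<And>x. x \<in> topspace K \<Longrightarrow> u x - v x = c"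
    using osc_eq_0[OF compact nonempty continuous_map_diff[OF assms]] by blast
  then show "normalized_exp u = normalized_exp v"
    by (intro normalized_exp_cong[of _ _ c]) (simp add: algebra_simps)
qed

lemma metric_on_simplex_interior: "metric_on (simplex_interior K \<mu>) (hilbert_dist K)"
  unfolding metric_on_def
proof (intro ballI conjI)
  fix f g assume f: "f \<in> simplex_interior K \<mu>" and g: "g \<in> simplex_interior K \<mu>"
  have d: "hilbert_dist K f g = osc K (\<lambda>x. ln (f x) - ln (g x))"
    if "f \<in> simplex_interior K \<mu>" "g \<in> simplex_interior K \<mu>" for f g
    using that by (intro hilbert_dist_eq_osc compact nonempty simplex_interiorD)
  note cont = simplex_interiorD(3)
  show "hilbert_dist K f g = hilbert_dist K g f"
    using osc_minus[OF compact nonempty continuous_map_diff[OF cont[OF f] cont[OF g]]]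
    by (simp add: d f g)
  show "hilbert_dist K f g = 0 \<longleftrightarrow> f = g"
    using normalized_exp_eq_iff[OF cont[OF f] cont[OF g]] normalized_exp_ln f g d by metis
  fix h assume h: "h \<in> simplex_interior K \<mu>"
  show "hilbert_dist K f h \<le> hilbert_dist K f g + hilbert_dist K g h"
    using osc_triangle[OF compact nonempty continuous_map_diff[OF cont[OF f] cont[OF g]]
        continuous_map_diff[OF cont[OF g] cont[OF h]]]
    by (simp add: d f g h)
qed

lemma normalized_exp_reflect:
  assumes "continuous_map K euclideanreal c" "continuous_map K euclideanreal u"
  shows "normalized_exp (\<lambda>x. c x - ln (normalized_exp u x)) = normalized_exp (\<lambda>x. c x - u x)"
  by (rule normalized_exp_cong[where c = "ln (\<integral>y. exp (u y) \<partial>\<mu>)"])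
    (simp add: ln_normalized_exp[OF assms(2)])

text \<open>In logarithmic coordinates this is the reflection sending u to c - u, centred at c/2.
  Doubling comes from (c - u) - u = -2(u - c/2).\<close>

lemma point_reflection_simplex_interior:
  assumes c: "continuous_map K euclideanreal c"
  shows "point_reflection (simplex_interior K \<mu>) (hilbert_dist K)
    (normalized_exp (\<lambda>x. c x / 2)) (\<lambda>f. normalized_exp (\<lambda>x. c x - ln (f x)))"
    (is "point_reflection ?X ?d ?z ?\<rho>")
proof -
  have c2: "continuous_map K euclideanreal (\<lambda>x. c x / 2)"
    using c by (intro continuous_map_real_divide) auto
  have cf: "continuous_map K euclideanreal (\<lambda>x. c x - ln (f x))" if "f \<in> ?X" for f
    using c simplex_interiorD(3)[OF that] by (rule continuous_map_diff)
  have mem: "?\<rho> f \<in> ?X" if "f \<in> ?X" for f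
    using cf[OF that] by (rule normalized_exp_mem)
  have involution: "?\<rho> (?\<rho> f) = f" if "f \<in> ?X" for f
    using normalized_exp_reflect[OF c cf[OF that]] normalized_exp_ln[OF that] by simp
  have "?\<rho> ?z = ?z"
    using normalized_exp_reflect[OF c c2] by (simp add: field_simps)
  moreover have "?\<rho> ` ?X = ?X"
  proof
    show "?X \<subseteq> ?\<rho> ` ?X"
    proof
      fix f assume "f \<in> ?X"
      then show "f \<in> ?\<rho> ` ?X"
        by (intro image_eqI[of _ _ "?\<rho> f"] involution[symmetric] mem)
    qed
  qed (use mem in blast)
  moreover have "?d (?\<rho> f) (?\<rho> g) = ?d f g" if "f \<in> ?X" "g \<in> ?X" for f g
  proof -
    have "?d (?\<rho> f) (?\<rho> g) = osc K (\<lambda>x. ln (g x) - ln (f x))"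
      using hilbert_dist_normalized_exp[OF cf cf, OF that] by simp
    also have "\<dots> = ?d (normalized_exp (\<lambda>x. ln (g x))) (normalized_exp (\<lambda>x. ln (f x)))"
      using that by (intro hilbert_dist_normalized_exp[symmetric] simplex_interiorD(3))
    also have "\<dots> = ?d f g"
      using metric_on_simplex_interior that by (simp add: normalized_exp_ln metric_on_def)
    finally show ?thesis .
  qed
  moreover have "?d (?\<rho> f) f = 2 * ?d f ?z" if "f \<in> ?X" for f
  proof -
    have lf: "continuous_map K euclideanreal (\<lambda>x. ln (f x))"
      by (rule simplex_interiorD(3)[OF that])
    have cont: "continuous_map K euclideanreal (\<lambda>x. ln (f x) - c x / 2)"
      using lf c2 by (rule continuous_map_diff)
    have "?d (?\<rho> f) f = ?d (?\<rho> f) (normalized_exp (\<lambda>x. ln (f x)))"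
      by (simp add: normalized_exp_ln[OF that])
    also have "\<dots> = osc K (\<lambda>x. c x - ln (f x) - ln (f x))"
      by (rule hilbert_dist_normalized_exp[OF cf[OF that] lf])
    also have "(\<lambda>x. c x - ln (f x) - ln (f x)) = (\<lambda>x. - (2 * (ln (f x) - c x / 2)))"
      by (simp add: fun_eq_iff)
    also have "osc K \<dots> = osc K (\<lambda>x. 2 * (ln (f x) - c x / 2))"
      by (intro osc_minus compact nonempty continuous_map_real_mult_left cont)
    also have "\<dots> = 2 * osc K (\<lambda>x. ln (f x) - c x / 2)"
      by (intro osc_mult_left compact nonempty cont) simp
    also have "osc K (\<lambda>x. ln (f x) - c x / 2) = ?d (normalized_exp (\<lambda>x. ln (f x))) ?z"
      by (rule hilbert_dist_normalized_exp[OF lf c2, symmetric])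
    finally show ?thesis
      by (simp add: normalized_exp_ln[OF that])
  qed
  ultimately show ?thesis
    using involution normalized_exp_mem[OF c2] unfolding point_reflection_def isometry_onto_def
    by (intro conjI ballI)
qed

end

section \<open>From isometries of simplices to additive correspondences\<close>

text \<open>The reflections with \<open>c\<close> equal to the sums \<open>u + v\<close> and
  \<open>a + b\<close> swap the given densities and have the midpoints as centres, so
  \<open>isometry_preserves_reflection_centre\<close> applies.\<close>

lemma simplex_isometry_midpoint:
  assumes 1: "positive_measure_on_compact K \<mu>" and 2: "positive_measure_on_compact L \<nu>"
    and T: "isometry_onto (simplex_interior K \<mu>) (hilbert_dist K) (simplex_interior L \<nu>) (hilbert_dist L) T"
    and K: "continuous_map K euclideanreal u" "continuous_map K euclideanreal v"
    and L: "continuous_map L euclideanreal a" "continuous_map L euclideanreal b"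
  defines "N \<equiv> positive_measure_on_compact.normalized_exp K \<mu>"
    and "M \<equiv> positive_measure_on_compact.normalized_exp L \<nu>"
  assumes Ta: "T (N u) = M a" and Tb: "T (N v) = M b"
  shows "T (N (\<lambda>x. (u x + v x) / 2)) = M (\<lambda>x. (a x + b x) / 2)"
proof -
  interpret K: positive_measure_on_compact K \<mu> by fact
  interpret L: positive_measure_on_compact L \<nu> by fact
  have s: "continuous_map K euclideanreal (\<lambda>x. u x + v x)" "continuous_map L euclideanreal (\<lambda>x. a x + b x)"
    using K L by (auto intro: continuous_map_add)
  show ?thesis
    unfolding N_def M_def
  proof (rule isometry_preserves_reflection_centre[OF K.metric_on_simplex_interior
        L.metric_on_simplex_interior T, OF K.point_reflection_simplex_interior[OF s(1)]
        L.point_reflection_simplex_interior[OF s(2)], OF K.normalized_exp_mem[OF K(1)]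
        K.normalized_exp_mem[OF K(2)] _ Ta[unfolded N_def M_def] Tb[unfolded N_def M_def]])
    show "K.normalized_exp (\<lambda>x. u x + v x - ln (K.normalized_exp u x)) = K.normalized_exp v"
      using K.normalized_exp_reflect[OF s(1) K(1)] by simp
    show "L.normalized_exp (\<lambda>x. a x + b x - ln (L.normalized_exp a x)) = L.normalized_exp b"
      using L.normalized_exp_reflect[OF s(2) L(1)] by simp
  qed
qed

text \<open>
  Subtracting \<open>c\<close>, the logarithm of the image of the uniform density, makes the isometry fix the
  origin; preserving midpoints, it is then additive modulo constants.
\<close>

lemma simplex_isometry_osc_corr:
  assumes 1: "positive_measure_on_compact K \<mu>" and 2: "positive_measure_on_compact L \<nu>"
    and T: "isometry_onto (simplex_interior K \<mu>) (hilbert_dist K) (simplex_interior L \<nu>) (hilbert_dist L) T"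
  obtains R where "osc_corr K L R"
proof -
  interpret K: positive_measure_on_compact K \<mu> by fact
  interpret L: positive_measure_on_compact L \<nu> by fact
  let ?N = "K.normalized_exp" and ?M = "L.normalized_exp"
  let ?CK = "\<lambda>u. continuous_map K euclideanreal u" and ?CL = "\<lambda>w. continuous_map L euclideanreal w"
  have mem: "T (?N u) \<in> simplex_interior L \<nu>" if "?CK u" for u
    using K.normalized_exp_mem[OF that] T by (auto simp: isometry_onto_def)
  define c where "c x = ln (T (?N (\<lambda>_. 0)) x)" for x
  have CK0: "?CK (\<lambda>_. 0)"
    by simp
  have c: "?CL c" "?M c = T (?N (\<lambda>_. 0))"
    using L.simplex_interiorD(3)[OF mem[OF CK0]] L.normalized_exp_ln[OF mem[OF CK0]]
    by (simp_all add: c_def[abs_def])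
  have cw: "?CL (\<lambda>x. c x + w x)" if "?CL w" for w
    using c(1) that by (rule continuous_map_add)
  define R where "R u w \<longleftrightarrow> ?CK u \<and> ?CL w \<and> T (?N u) = ?M (\<lambda>x. c x + w x)" for u w
  have zero: "R (\<lambda>_. 0) (\<lambda>_. 0)"
    using c by (simp add: R_def)
  have total: "\<exists>w. R u w" if u: "?CK u" for u
  proof -
    let ?w = "\<lambda>x. ln (T (?N u) x) - c x"
    have "?CL ?w"
      using L.simplex_interiorD(3)[OF mem[OF u]] c(1) by (rule continuous_map_diff)
    moreover have "?M (\<lambda>x. c x + ?w x) = T (?N u)"
      using L.normalized_exp_ln[OF mem[OF u]] by simp
    ultimately have "R u ?w"
      using u by (simp add: R_def)
    then show ?thesis by blast
  qed
  have onto: "\<exists>u. R u w" if w: "?CL w" for w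
  proof -
    obtain f where f: "f \<in> simplex_interior K \<mu>" "T f = ?M (\<lambda>x. c x + w x)"
      using L.normalized_exp_mem[OF cw[OF w]] T unfolding isometry_onto_def by (metis imageE)
    then have "R (\<lambda>x. ln (f x)) w"
      using w K.simplex_interiorD(3)[OF f(1)] K.normalized_exp_ln[OF f(1)] by (simp add: R_def)
    then show ?thesis by blast
  qed
  have osc: "osc K u = osc L w" if R: "R u w" for u w
  proof -
    have u: "?CK u" and w: "?CL w" and eq: "T (?N u) = ?M (\<lambda>x. c x + w x)"
      using R by (auto simp: R_def)
    have "osc K u = hilbert_dist K (?N u) (?N (\<lambda>_. 0))"
      using K.hilbert_dist_normalized_exp[OF u CK0] by simp
    also have "\<dots> = hilbert_dist L (T (?N u)) (T (?N (\<lambda>_. 0)))"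
      using T K.normalized_exp_mem[OF u] K.normalized_exp_mem[OF CK0] by (simp add: isometry_onto_def)
    also have "\<dots> = osc L w"
      using L.hilbert_dist_normalized_exp[OF cw[OF w] c(1)] c(2) eq by simp
    finally show ?thesis .
  qed
  have mid: "R (\<lambda>x. (u x + u' x) / 2) (\<lambda>x. (w x + w' x) / 2)" if "R u w" "R u' w'" for u u' w w'
  proof -
    have "T (?N (\<lambda>x. (u x + u' x) / 2)) = ?M (\<lambda>x. ((c x + w x) + (c x + w' x)) / 2)"
      using that cw by (intro simplex_isometry_midpoint[OF 1 2 T]) (auto simp: R_def)
    also have "(\<lambda>x. ((c x + w x) + (c x + w' x)) / 2) = (\<lambda>x. c x + (w x + w' x) / 2)"
      by (simp add: fun_eq_iff field_simps)
    finally show ?thesis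
      using that by (auto simp: R_def intro!: continuous_map_real_divide continuous_map_add)
  qed
  have same: "\<exists>k. \<forall>x\<in>topspace L. w' x - w x = k" if "R u w" "R u w'" for u w w'
  proof -
    have C: "?CL (\<lambda>x. c x + w x)" "?CL (\<lambda>x. c x + w' x)"
      using that cw unfolding R_def by blast+
    have "?M (\<lambda>x. c x + w' x) = ?M (\<lambda>x. c x + w x)"
      using that by (simp add: R_def)
    then have "osc L (\<lambda>x. (c x + w' x) - (c x + w x)) = 0"
      using L.normalized_exp_eq_iff[OF C(2,1)] by blast
    then obtain k where "\<And>x. x \<in> topspace L \<Longrightarrow> (c x + w' x) - (c x + w x) = k"
      using osc_eq_0[OF L.compact L.nonempty continuous_map_diff[OF C(2,1)]] by blast
    then show ?thesis
      by auto
  qed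
  \<comment> \<open>The midpoint of \<open>2 * u\<close> and 0 is \<open>u\<close>. Half of any
    partner \<open>w2\<close> of \<open>2 * u\<close> is therefore a partner of \<open>u\<close>,
    and \<open>w2\<close> differs from \<open>2 * w\<close> by the constant
    \<open>2 * k\<close>.\<close>
  have double: "R (\<lambda>x. 2 * u x) (\<lambda>x. 2 * w x)" if R: "R u w" for u w
  proof -
    have C: "?CK (\<lambda>x. 2 * u x)" "?CL (\<lambda>x. 2 * w x)"
      using R by (auto simp: R_def intro: continuous_map_real_mult_left)
    obtain w2 where w2: "R (\<lambda>x. 2 * u x) w2"
      using total[OF C(1)] by blast
    have half: "R u (\<lambda>x. w2 x / 2)"
      using mid[OF w2 zero] by simp
    obtain k where k: "\<forall>x\<in>topspace L. w2 x / 2 - w x = k"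
      using same[OF R half] by blast
    have "?M (\<lambda>x. c x + w2 x) = ?M (\<lambda>x. c x + 2 * w x)"
      by (rule L.normalized_exp_cong[where c = "2 * k"]) (use k in force)
    then show ?thesis
      using w2 C by (simp add: R_def)
  qed
  have "osc_corr K L R"
    unfolding osc_corr_def
  proof (intro conjI allI impI)
    \<comment> \<open>A sum is the midpoint of the doubled summands.\<close>
    show "R (\<lambda>x. u x + u' x) (\<lambda>x. w x + w' x)" if "R u w" "R u' w'" for u w u' w'
      using mid[OF double[OF that(1)] double[OF that(2)]] by (simp add: add_divide_distrib)
    show "R (\<lambda>x. - u x) (\<lambda>x. - w x)" if R: "R u w" for u w
    proof -
      have C: "?CK (\<lambda>x. - u x)" "?CL (\<lambda>x. - w x)"
        using R by (auto simp: R_def)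
      obtain w' where w': "R (\<lambda>x. - u x) w'"
        using total[OF C(1)] by blast
      \<comment> \<open>The midpoint of \<open>u\<close> and its negative is 0, so
        \<open>w + w'\<close> is constant on \<open>L\<close>.\<close>
      have half: "R (\<lambda>_. 0) (\<lambda>x. (w x + w' x) / 2)"
        using mid[OF R w'] by simp
      obtain k where k: "\<forall>x\<in>topspace L. (w x + w' x) / 2 - 0 = k"
        using same[OF zero half] by blast
      have "?M (\<lambda>x. c x + w' x) = ?M (\<lambda>x. c x + - w x)"
        by (rule L.normalized_exp_cong[where c = "2 * k"]) (use k in force)
      then show ?thesis
        using w' C by (simp add: R_def)
    qed
    show "?CK u" "?CL w" if "R u w" for u w
      using that by (simp_all add: R_def)
  qed (use zero total onto osc in \<open>blast+\<close>)
  then show ?thesis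
    by (rule that)
qed

section \<open>Homeomorphic spaces\<close>

lemma osc_compose_surj:
  assumes "h ` topspace L = topspace K"
  shows "osc L (\<lambda>y. u (h y)) = osc K u"
proof -
  have "(\<lambda>(x, y). u (h x) - u (h y)) ` (topspace L \<times> topspace L) =
      (\<lambda>(x, y). u x - u y) ` (h ` topspace L \<times> h ` topspace L)"
    by force
  then show ?thesis
    using assms by (simp add: osc_def)
qed

text \<open>Logarithms are pulled back along \<open>g\<close> and normalized again with respect to
  \<open>\<nu>\<close>, since the homeomorphism need not carry \<open>\<mu>\<close> to
  \<open>\<nu>\<close>. The resulting shift by a constant leaves the oscillation unchanged.\<close>

lemma homeomorphic_imp_simplex_isometry:
  assumes 1: "positive_measure_on_compact K \<mu>" and 2: "positive_measure_on_compact L \<nu>"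
    and fg: "homeomorphic_maps K L f g"
  shows "isometric (simplex_interior K \<mu>) (hilbert_dist K) (simplex_interior L \<nu>) (hilbert_dist L)"
proof -
  interpret K: positive_measure_on_compact K \<mu> by fact
  interpret L: positive_measure_on_compact L \<nu> by fact
  have f: "continuous_map K L f" and g: "continuous_map L K g"
    and gf: "\<And>x. x \<in> topspace K \<Longrightarrow> g (f x) = x" and fg: "\<And>y. y \<in> topspace L \<Longrightarrow> f (g y) = y"
    using fg by (auto simp: homeomorphic_maps_def)
  have surj: "g ` topspace L = topspace K"
    using f g gf by (force simp: continuous_map_def Pi_iff image_iff)
  have compg: "continuous_map L euclideanreal (\<lambda>y. u (g y))" if "continuous_map K euclideanreal u" for u
    using continuous_map_compose[OF g that] by (simp add: o_def)
  have compf: "continuous_map K euclideanreal (\<lambda>x. u (f x))" if "continuous_map L euclideanreal u" for u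
    using continuous_map_compose[OF f that] by (simp add: o_def)
  define \<phi> where "\<phi> F = L.normalized_exp (\<lambda>y. ln (F (g y)))" for F
  have \<phi>_mem: "\<phi> F \<in> simplex_interior L \<nu>" if "F \<in> simplex_interior K \<mu>" for F
    unfolding \<phi>_def by (intro L.normalized_exp_mem compg K.simplex_interiorD(3) that)
  have "hilbert_dist L (\<phi> F) (\<phi> G) = hilbert_dist K F G"
    if F: "F \<in> simplex_interior K \<mu>" and G: "G \<in> simplex_interior K \<mu>" for F G
  proof -
    have "hilbert_dist L (\<phi> F) (\<phi> G) = osc L (\<lambda>y. ln (F (g y)) - ln (G (g y)))"
      unfolding \<phi>_def
      by (intro L.hilbert_dist_normalized_exp compg[OF K.simplex_interiorD(3)[OF F]]
          compg[OF K.simplex_interiorD(3)[OF G]])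
    also have "\<dots> = osc K (\<lambda>x. ln (F x) - ln (G x))"
      by (rule osc_compose_surj[OF surj, of "\<lambda>x. ln (F x) - ln (G x)"])
    also have "\<dots> = hilbert_dist K F G"
      using K.hilbert_dist_normalized_exp[OF K.simplex_interiorD(3)[OF F] K.simplex_interiorD(3)[OF G]]
      by (simp add: K.normalized_exp_ln F G)
    finally show ?thesis .
  qed
  moreover have "\<phi> ` simplex_interior K \<mu> = simplex_interior L \<nu>"
  proof
    show "simplex_interior L \<nu> \<subseteq> \<phi> ` simplex_interior K \<mu>"
    proof
      fix H assume H: "H \<in> simplex_interior L \<nu>"
      have cont: "continuous_map K euclideanreal (\<lambda>x. ln (H (f x)))"
        by (rule compf[OF L.simplex_interiorD(3)[OF H]])
      \<comment> \<open>The preimage of \<open>H\<close> is found by pulling its logarithm back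
        along \<open>f\<close> and normalizing with respect to \<open>\<mu>\<close>.\<close>
      have "\<phi> (K.normalized_exp (\<lambda>x. ln (H (f x)))) = L.normalized_exp (\<lambda>y. ln (H y))"
        unfolding \<phi>_def
      proof (rule L.normalized_exp_cong)
        fix y assume y: "y \<in> topspace L"
        then have "g y \<in> topspace K"
          using surj by blast
        then show "ln (K.normalized_exp (\<lambda>x. ln (H (f x))) (g y)) =
            ln (H y) + - ln (\<integral>x. exp (ln (H (f x))) \<partial>\<mu>)"
          by (simp only: K.ln_normalized_exp[OF cont] fg[OF y] diff_conv_add_uminus)
      qed
      then show "H \<in> \<phi> ` simplex_interior K \<mu>"
        using L.normalized_exp_ln[OF H] K.normalized_exp_mem[OF cont] by (metis image_eqI)
    qed
  qed (use \<phi>_mem in blast)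
  ultimately show ?thesis
    unfolding isometric_def by blast
qed

text \<open>On the empty space every integral is 0, never 1; on a nonempty one the uniform density
  is a member.\<close>

lemma simplex_interior_eq_empty_iff:
  assumes "compact_space K" "borel_measure_on K \<mu>" "finite_measure \<mu>" "strictly_positive_on K \<mu>"
  shows "simplex_interior K \<mu> = {} \<longleftrightarrow> topspace K = {}"
proof
  assume "topspace K = {}"
  then have "(\<integral>x. f x \<partial>\<mu>) = 0" for f :: "'a \<Rightarrow> real"
    using borel_measure_on_space[OF assms(2)] by (intro integral_eq_zero_AE AE_I2) auto
  then show "simplex_interior K \<mu> = {}"
    by (simp add: simplex_interior_def)
next
  assume empty: "simplex_interior K \<mu> = {}"
  show "topspace K = {}"
  proof (rule ccontr)
    assume "topspace K \<noteq> {}"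
    then interpret positive_measure_on_compact K \<mu>
      using assms by (simp add: positive_measure_on_compact_def)
    have "normalized_exp (\<lambda>_. 0) \<in> simplex_interior K \<mu>"
      by (rule normalized_exp_mem) simp
    with empty show False by blast
  qed
qed

theorem corollary1p3:
  fixes K1 :: "'a topology" and K2 :: "'b topology"
    and \<mu>1 :: "'a measure" and \<mu>2 :: "'b measure"
  assumes "compact_space K1" and "Hausdorff_space K1"
    and "compact_space K2" and "Hausdorff_space K2"
    and "borel_measure_on K1 \<mu>1" and "finite_measure \<mu>1" and "strictly_positive_on K1 \<mu>1"
    and "borel_measure_on K2 \<mu>2" and "finite_measure \<mu>2" and "strictly_positive_on K2 \<mu>2"
  shows "isometric (simplex_interior K1 \<mu>1) (hilbert_dist K1)
                   (simplex_interior K2 \<mu>2) (hilbert_dist K2)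
         \<longleftrightarrow> K1 homeomorphic_space K2"
\<comment> \<open>Oscillations need a nonempty carrier. If one space is empty, both sides of the
  equivalence say that the other is empty too.\<close>
proof (cases "topspace K1 = {} \<or> topspace K2 = {}")
  case True
  have empty1: "simplex_interior K1 \<mu>1 = {} \<longleftrightarrow> topspace K1 = {}"
    and empty2: "simplex_interior K2 \<mu>2 = {} \<longleftrightarrow> topspace K2 = {}"
    using simplex_interior_eq_empty_iff assms by blast+
  have "isometric (simplex_interior K1 \<mu>1) (hilbert_dist K1) (simplex_interior K2 \<mu>2) (hilbert_dist K2)
      \<longleftrightarrow> (simplex_interior K1 \<mu>1 = {} \<longleftrightarrow> simplex_interior K2 \<mu>2 = {})"
    using True empty1 empty2 by (auto simp: isometric_def)
  also have "\<dots> \<longleftrightarrow> (topspace K1 = {} \<longleftrightarrow> topspace K2 = {})"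
    by (simp only: empty1 empty2)
  also have "\<dots> \<longleftrightarrow> K1 homeomorphic_space K2"
    using True homeomorphic_empty_space[of K1 K2] homeomorphic_empty_space_eq[of K1 K2] by auto
  finally show ?thesis .
next
  case False
  then have K1: "positive_measure_on_compact K1 \<mu>1" and K2: "positive_measure_on_compact K2 \<mu>2"
    using assms by (simp_all add: positive_measure_on_compact_def)
  show ?thesis
  proof
    assume "isometric (simplex_interior K1 \<mu>1) (hilbert_dist K1) (simplex_interior K2 \<mu>2) (hilbert_dist K2)"
    then obtain T where "isometry_onto (simplex_interior K1 \<mu>1) (hilbert_dist K1) (simplex_interior K2 \<mu>2) (hilbert_dist K2) T"
      unfolding isometric_def isometry_onto_def by blast
    then obtain R where "osc_corr K1 K2 R"
      using simplex_isometry_osc_corr[OF K1 K2] by blast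
    then show "K1 homeomorphic_space K2"
      using False assms(1-4) by (intro osc_corr_imp_homeomorphic) auto
  next
    assume "K1 homeomorphic_space K2"
    then obtain f g where "homeomorphic_maps K1 K2 f g"
      unfolding homeomorphic_space_def by blast
    then show "isometric (simplex_interior K1 \<mu>1) (hilbert_dist K1) (simplex_interior K2 \<mu>2) (hilbert_dist K2)"
      by (rule homeomorphic_imp_simplex_isometry[OF K1 K2])
  qed
qed

end
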